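(* Let $1<p<q<\infty$ and $1<r<\infty$, and let $p',q',r'$ be the conjugate exponents. Then the block space $\mathrm h^{p'}_{q',r'}(\mathbb Z)$ is a predual of $\ell^p_{q,r}(\mathbb Z)$, and one has the duality identifications $$(\ell^p_{q,r}(\mathbb Z))^*\cong \mathrm h^{p'}_{q',r'}(\mathbb Z)\qquad\text{and}\qquad(\mathrm h^{p'}_{q',r'}(\mathbb Z))^*\cong\ell^p_{q,r}(\mathbb Z),$$ with isometric isomorphisms.
   Context: For $j\in\mathbb N_0=\{0,1,2,\dots\}$ and $k\in\mathbb Z$ let $I(j,k)=[2^jk,2^j(k+1))\cap\mathbb Z$, with $|I(j,k)|=2^j$ elements; these are the dyadic intervals. All sequences are real. For a sequence $x\in\mathbb R^{\mathbb Z}$ put $$\|x\|_{\ell^p_{q,r}}=\Big(\sum_{j=0}^\infty\sum_{k\in\mathbb Z}(2^j)^{r(\frac1q-\frac1p)}\Big(\sum_{l\in I(j,k)}|x(l)|^p\Big)^{r/p}\Big)^{1/r},$$ and let $\ell^p_{q,r}(\mathbb Z)$ be the space of all $x$ with $\|x\|_{\ell^p_{q,r}}<\infty$. A $(q',p')$-block with respect to a dyadic interval $I$ is a sequence $a\in\mathbb R^{\mathbb Z}$ with $\operatorname{supp}a\subset I$ and $\|a\|_{\ell^{p'}}\le|I|^{\frac1{p'}-\frac1{q'}}$. The block space $\mathrm h^{p'}_{q',r'}(\mathbb Z)$ is the set of all $y\in\mathbb R^{\mathbb Z}$ that can be written as $$y=\sum_{(j,k)\in\mathbb N_0\times\mathbb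 Z}\lambda^j_k a^j_k,$$ with $\lambda=(\lambda^j_k)\in\ell^{r'}(\mathbb N_0\times\mathbb Z)$ and each $a^j_k$ a $(q',p')$-block with respect to $I(j,k)$, the series converging in $\ell^1_{\mathrm{loc}}$ (i.e. in $\ell^1$ on every finite subset of $\mathbb Z$). Its norm is $\|y\|_{\mathrm h^{p'}_{q',r'}}=\inf\|\lambda\|_{\ell^{r'}}$, the infimum being over all such representations. *)

theory Defs
  imports "HOL-Analysis.Analysis"
begin

text \<open>
  A normed space here is a set \<open>V\<close> of real-valued functions with pointwise operations together
  with a function \<open>N\<close> of which only the values on \<open>V\<close> matter. Both sequence spaces and dual spaces
  are of this form (index type \<open>int\<close>, resp. the type of the vectors the functionals act on).
\<close>

definition normed_on :: "('a \<Rightarrow> real) set \<Rightarrow> (('a \<Rightarrow> real) \<Rightarrow> real) \<Rightarrow> bool" where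
  "normed_on V N \<longleftrightarrow>
     (\<lambda>i. 0) \<in> V \<and>
     (\<forall>x\<in>V. \<forall>y\<in>V. (\<lambda>i. x i + y i) \<in> V) \<and>
     (\<forall>c. \<forall>x\<in>V. (\<lambda>i. c * x i) \<in> V) \<and>
     (\<forall>x\<in>V. 0 \<le> N x) \<and>
     (\<forall>x\<in>V. N x = 0 \<longleftrightarrow> x = (\<lambda>i. 0)) \<and>
     (\<forall>c. \<forall>x\<in>V. N (\<lambda>i. c * x i) = \<bar>c\<bar> * N x) \<and>
     (\<forall>x\<in>V. \<forall>y\<in>V. N (\<lambda>i. x i + y i) \<le> N x + N y)"

definition banach_on :: "('a \<Rightarrow> real) set \<Rightarrow> (('a \<Rightarrow> real) \<Rightarrow> real) \<Rightarrow> bool" where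
  "banach_on V N \<longleftrightarrow> normed_on V N \<and>
     (\<forall>s :: nat \<Rightarrow> 'a \<Rightarrow> real.
        (\<forall>n. s n \<in> V) \<and> (\<forall>e>0. \<exists>K. \<forall>m\<ge>K. \<forall>n\<ge>K. N (\<lambda>i. s m i - s n i) < e)
        \<longrightarrow> (\<exists>x\<in>V. (\<lambda>n. N (\<lambda>i. s n i - x i)) \<longlonglongrightarrow> 0))"

text \<open>
  Functionals are total functions in HOL. Requiring the value \<open>0\<close> off \<open>V\<close> makes a functional
  determined by its restriction to \<open>V\<close> and is compatible with pointwise operations.
\<close>

definition dual_space ::
    "('a \<Rightarrow> real) set \<Rightarrow> (('a \<Rightarrow> real) \<Rightarrow> real) \<Rightarrow> (('a \<Rightarrow> real) \<Rightarrow> real) set" where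
  "dual_space V N = {\<phi>.
     (\<forall>x\<in>V. \<forall>y\<in>V. \<phi> (\<lambda>i. x i + y i) = \<phi> x + \<phi> y) \<and>
     (\<forall>c. \<forall>x\<in>V. \<phi> (\<lambda>i. c * x i) = c * \<phi> x) \<and>
     (\<exists>C. \<forall>x\<in>V. \<bar>\<phi> x\<bar> \<le> C * N x) \<and>
     (\<forall>x. x \<notin> V \<longrightarrow> \<phi> x = 0)}"

definition dual_norm ::
    "('a \<Rightarrow> real) set \<Rightarrow> (('a \<Rightarrow> real) \<Rightarrow> real) \<Rightarrow> (('a \<Rightarrow> real) \<Rightarrow> real) \<Rightarrow> real" where
  "dual_norm V N \<phi> = Sup {\<bar>\<phi> x\<bar> | x. x \<in> V \<and> N x \<le> 1}"

definition isometric_isomorphism ::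
    "('a \<Rightarrow> real) set \<Rightarrow> (('a \<Rightarrow> real) \<Rightarrow> real) \<Rightarrow> ('b \<Rightarrow> real) set \<Rightarrow> (('b \<Rightarrow> real) \<Rightarrow> real) \<Rightarrow>
     (('a \<Rightarrow> real) \<Rightarrow> ('b \<Rightarrow> real)) \<Rightarrow> bool" where
  "isometric_isomorphism V N W M T \<longleftrightarrow>
     bij_betw T V W \<and>
     (\<forall>x\<in>V. \<forall>y\<in>V. T (\<lambda>i. x i + y i) = (\<lambda>i. T x i + T y i)) \<and>
     (\<forall>c. \<forall>x\<in>V. T (\<lambda>i. c * x i) = (\<lambda>i. c * T x i)) \<and>
     (\<forall>x\<in>V. M (T x) = N x)"

definition is_predual ::
    "('a \<Rightarrow> real) set \<Rightarrow> (('a \<Rightarrow> real) \<Rightarrow> real) \<Rightarrow> ('b \<Rightarrow> real) set \<Rightarrow> (('b \<Rightarrow> real) \<Rightarrow> real) \<Rightarrow> bool" where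
  "is_predual V N W M \<longleftrightarrow> banach_on V N \<and> banach_on W M \<and>
     (\<exists>T. isometric_isomorphism W M (dual_space V N) (dual_norm V N) T)"

text \<open>The functional on \<open>V\<close> induced by \<open>z\<close> through the bilinear pairing of sequences.\<close>

definition pairing_functional ::
    "(int \<Rightarrow> real) set \<Rightarrow> (int \<Rightarrow> real) \<Rightarrow> (int \<Rightarrow> real) \<Rightarrow> real" where
  "pairing_functional V z = (\<lambda>v. if v \<in> V then (\<Sum>\<^sub>\<infinity>l. v l * z l) else 0)"

definition lp_space :: "real \<Rightarrow> ('i \<Rightarrow> real) set" where
  "lp_space s = {x. (\<lambda>i. \<bar>x i\<bar> powr s) summable_on UNIV}"

definition lp_norm :: "real \<Rightarrow> ('i \<Rightarrow> real) \<Rightarrow> real" where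
  "lp_norm s x = (\<Sum>\<^sub>\<infinity>i. \<bar>x i\<bar> powr s) powr (1 / s)"

definition dyadic :: "nat \<Rightarrow> int \<Rightarrow> int set" where
  "dyadic j k = {2 ^ j * k ..< 2 ^ j * (k + 1)}"

text \<open>
  The sum over \<open>j\<close> and \<open>k\<close> has nonnegative terms, so it is taken as one unordered sum over pairs;
  it is finite iff the family is summable.
\<close>

definition bm_term :: "real \<Rightarrow> real \<Rightarrow> real \<Rightarrow> (int \<Rightarrow> real) \<Rightarrow> nat \<times> int \<Rightarrow> real" where
  "bm_term p q r x = (\<lambda>(j, k).
     (2 ^ j) powr (r * (1 / q - 1 / p)) * (\<Sum>l\<in>dyadic j k. \<bar>x l\<bar> powr p) powr (r / p))"

definition bm_space :: "real \<Rightarrow> real \<Rightarrow> real \<Rightarrow> (int \<Rightarrow> real) set" where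
  "bm_space p q r = {x. bm_term p q r x summable_on UNIV}"

definition bm_norm :: "real \<Rightarrow> real \<Rightarrow> real \<Rightarrow> (int \<Rightarrow> real) \<Rightarrow> real" where
  "bm_norm p q r x = (\<Sum>\<^sub>\<infinity>jk. bm_term p q r x jk) powr (1 / r)"

text \<open>In the following definitions the exponents \<open>p'\<close>, \<open>q'\<close>, \<open>r'\<close> are independent parameters.\<close>

definition is_block :: "real \<Rightarrow> real \<Rightarrow> nat \<Rightarrow> int \<Rightarrow> (int \<Rightarrow> real) \<Rightarrow> bool" where
  "is_block q' p' j k a \<longleftrightarrow>
     {l. a l \<noteq> 0} \<subseteq> dyadic j k \<and>
     lp_norm p' a \<le> real (card (dyadic j k)) powr (1 / p' - 1 / q')"

text \<open>Unordered convergence of the series \<open>f\<close> to \<open>y\<close> in \<open>\<ell>\<^sup>1(F)\<close> for every finite set \<open>F\<close>.\<close>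

definition has_sum_l1_loc :: "('i \<Rightarrow> int \<Rightarrow> real) \<Rightarrow> (int \<Rightarrow> real) \<Rightarrow> bool" where
  "has_sum_l1_loc f y \<longleftrightarrow>
     (\<forall>F. finite F \<longrightarrow>
        ((\<lambda>S. \<Sum>l\<in>F. \<bar>(\<Sum>i\<in>S. f i l) - y l\<bar>) \<longlongrightarrow> 0) (finite_subsets_at_top UNIV))"

definition block_rep ::
    "real \<Rightarrow> real \<Rightarrow> real \<Rightarrow> (int \<Rightarrow> real) \<Rightarrow> (nat \<times> int \<Rightarrow> real) \<Rightarrow> (nat \<times> int \<Rightarrow> int \<Rightarrow> real) \<Rightarrow> bool" where
  "block_rep p' q' r' y c a \<longleftrightarrow>
     c \<in> lp_space r' \<and>
     (\<forall>j k. is_block q' p' j k (a (j, k))) \<and>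
     has_sum_l1_loc (\<lambda>jk l. c jk * a jk l) y"

definition block_space :: "real \<Rightarrow> real \<Rightarrow> real \<Rightarrow> (int \<Rightarrow> real) set" where
  "block_space p' q' r' = {y. \<exists>c a. block_rep p' q' r' y c a}"

definition block_norm :: "real \<Rightarrow> real \<Rightarrow> real \<Rightarrow> (int \<Rightarrow> real) \<Rightarrow> real" where
  "block_norm p' q' r' y = Inf {lp_norm r' c | c a. block_rep p' q' r' y c a}"

end

theory Submission
  imports Defs
begin

text \<open>
  Why the dualities hold. Write \<open>w\<close> for \<open>|I|\<close> to the power \<open>1/q - 1/p\<close>, which equals
  \<open>1/p' - 1/q'\<close>. The norm of \<open>x\<close> in \<open>bm_space p q r\<close> is the \<open>\<ell>\<^sup>r\<close> norm of the family of weighted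
  local norms \<open>w * \<parallel>x\<parallel>\<close> in \<open>\<ell>\<^sup>p\<close> of \<open>I\<close>, and a block on \<open>I\<close> is a sequence on \<open>I\<close> with
  \<open>\<ell>\<close>-\<open>p'\<close> norm at most \<open>w\<close>. Hoelder's inequality on each \<open>I\<close> and then over all \<open>I\<close>, applied to
  partial sums of a block representation, bounds the pairing of \<open>x\<close> and \<open>y\<close> by the product of
  their norms (\<open>mixed_atomic_pair_le\<close>). The substance lies in two converse statements, in which
  pairing with finitely supported sequences already detects membership and norm.

  If \<open>x\<close> pairs with finitely supported \<open>y\<close> as a functional of norm at most \<open>C\<close>, then testing with the
  finite block sums built from the duality map of \<open>x\<close>, for which Hoelder is an equality, bounds
  every finite part of the norm of \<open>x\<close> by \<open>C\<close> (\<open>mixed_space_norming\<close>).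

  If \<open>y\<close> pairs with finitely supported \<open>x\<close> as a functional of norm at most \<open>C\<close>, a block representation
  of \<open>y\<close> has to be produced (\<open>atomic_space_norming\<close>). On a finite set of coordinates, and with the
  norm cut down to finitely many intervals, the functional attains its maximum on the compact unit
  ball. Since \<open>1 < p\<close> and \<open>1 < r\<close>, the norm is differentiable there, and the Lagrange condition at
  the maximizer writes \<open>y\<close> as a multiple of a gradient, which is a sum of blocks of the correct norm
  (\<open>finite_duality\<close>). Cutting down the norm costs an arbitrarily small \<open>e\<close>, by compactness
  (\<open>finite_subfamily_suffices\<close>). The families of pieces obtained for different finite sets all
  live in one product of compact intervals, and being a representation of norm at most \<open>C + e\<close> is
  an intersection of closed conditions on finitely many coordinates, so Tychonoff's theorem gives a
  representation of \<open>y\<close> itself. As the norm is an infimum, letting \<open>e\<close> tend to \<open>0\<close> gives norm at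
  most \<open>C\<close>.

  These facts are symmetric in the two spaces up to exchanging their roles. The locale \<open>dual_pair\<close>
  derives from them, and from the density of the finitely supported sequences, that both functions
  are norms, that the pairing gives both isometric isomorphisms, and, since dual spaces are
  complete, that both spaces are complete. The triangle inequalities hold because the norming property
  makes each norm a supremum of absolute values of linear functionals.

  Of the dyadic intervals the argument uses only that they are finite, cover the integers, and that
  the sum of \<open>w\<close> to the power \<open>r\<close> over the intervals containing a given point is finite. The last
  point is a geometric series, convergent because \<open>p < q\<close>.
\<close>

section \<open>Dual spaces are complete\<close>

lemma normed_onD:
  assumes "normed_on V N"
  shows "(\<lambda>i. 0) \<in> V"
    and "\<And>x y. x \<in> V \<Longrightarrow> y \<in> V \<Longrightarrow> (\<lambda>i. x i + y i) \<in> V"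
    and "\<And>c x. x \<in> V \<Longrightarrow> (\<lambda>i. c * x i) \<in> V"
    and "\<And>x. x \<in> V \<Longrightarrow> 0 \<le> N x"
    and "\<And>x. x \<in> V \<Longrightarrow> N x = 0 \<longleftrightarrow> x = (\<lambda>i. 0)"
    and "\<And>c x. x \<in> V \<Longrightarrow> N (\<lambda>i. c * x i) = \<bar>c\<bar> * N x"
    and "\<And>x y. x \<in> V \<Longrightarrow> y \<in> V \<Longrightarrow> N (\<lambda>i. x i + y i) \<le> N x + N y"
  using assms unfolding normed_on_def by blast+

lemma normed_on_diff:
  assumes "normed_on V N" "x \<in> V" "y \<in> V"
  shows "(\<lambda>i. x i - y i) \<in> V"
  using normed_onD(2)[OF assms(1,2) normed_onD(3)[OF assms(1,3), of "-1"]] by simp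

lemma dual_spaceD:
  assumes "\<phi> \<in> dual_space V N"
  shows "\<And>x y. x \<in> V \<Longrightarrow> y \<in> V \<Longrightarrow> \<phi> (\<lambda>i. x i + y i) = \<phi> x + \<phi> y"
    and "\<And>c x. x \<in> V \<Longrightarrow> \<phi> (\<lambda>i. c * x i) = c * \<phi> x"
    and "\<exists>C. \<forall>x\<in>V. \<bar>\<phi> x\<bar> \<le> C * N x"
    and "\<And>x. x \<notin> V \<Longrightarrow> \<phi> x = 0"
  using assms unfolding dual_space_def by blast+

lemma dual_spaceI:
  assumes "\<And>x y. x \<in> V \<Longrightarrow> y \<in> V \<Longrightarrow> \<phi> (\<lambda>i. x i + y i) = \<phi> x + \<phi> y"
    and "\<And>c x. x \<in> V \<Longrightarrow> \<phi> (\<lambda>i. c * x i) = c * \<phi> x"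
    and "\<And>x. x \<in> V \<Longrightarrow> \<bar>\<phi> x\<bar> \<le> C * N x"
    and "\<And>x. x \<notin> V \<Longrightarrow> \<phi> x = 0"
  shows "\<phi> \<in> dual_space V N"
  using assms unfolding dual_space_def by blast

lemma dual_space_diff:
  assumes "normed_on V N" "\<phi> \<in> dual_space V N" "x \<in> V" "y \<in> V"
  shows "\<phi> (\<lambda>i. x i - y i) = \<phi> x - \<phi> y"
  using dual_spaceD(1)[OF assms(2,3) normed_onD(3)[OF assms(1,4), of "-1"]]
    dual_spaceD(2)[OF assms(2,4), of "-1"] by simp

lemma dual_norm_bdd:
  assumes "normed_on V N" "\<phi> \<in> dual_space V N"
  shows "bdd_above {\<bar>\<phi> x\<bar> | x. x \<in> V \<and> N x \<le> 1}"
proof -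
  obtain C where C: "\<And>x. x \<in> V \<Longrightarrow> \<bar>\<phi> x\<bar> \<le> C * N x" using dual_spaceD(3)[OF assms(2)] by blast
  have "\<bar>\<phi> x\<bar> \<le> \<bar>C\<bar>" if "x \<in> V" "N x \<le> 1" for x
  proof -
    have "C * N x \<le> \<bar>C\<bar> * N x"
      using normed_onD(4)[OF assms(1) that(1)] by (simp add: mult_right_mono)
    also have "\<dots> \<le> \<bar>C\<bar> * 1" using that(2) by (intro mult_left_mono) auto
    finally show ?thesis using C[OF that(1)] by simp
  qed
  then show ?thesis by (intro bdd_aboveI[of _ "\<bar>C\<bar>"]) auto
qed

lemma dual_norm_nonneg:
  assumes "normed_on V N" "\<phi> \<in> dual_space V N"
  shows "0 \<le> dual_norm V N \<phi>"
proof -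
  have "N (\<lambda>i. 0) = 0" using normed_onD(1,5)[OF assms(1)] by blast
  then have "\<bar>\<phi> (\<lambda>i. 0)\<bar> \<le> dual_norm V N \<phi>"
    unfolding dual_norm_def
    by (intro cSup_upper dual_norm_bdd assms) (use normed_onD(1)[OF assms(1)] in auto)
  then show ?thesis by linarith
qed

lemma dual_norm_bound:
  assumes "normed_on V N" "\<phi> \<in> dual_space V N" "x \<in> V"
  shows "\<bar>\<phi> x\<bar> \<le> dual_norm V N \<phi> * N x"
proof (cases "N x = 0")
  case True
  then show ?thesis using dual_spaceD(3)[OF assms(2)] assms(3) by force
next
  case False
  then have pos: "N x > 0" using normed_onD(4)[OF assms(1,3)] by simp
  have "N (\<lambda>i. (1 / N x) * x i) = 1"
    using normed_onD(6)[OF assms(1,3), of "1 / N x"] pos by simp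
  then have "\<bar>\<phi> (\<lambda>i. (1 / N x) * x i)\<bar> \<le> dual_norm V N \<phi>"
    unfolding dual_norm_def using normed_onD(3)[OF assms(1,3)]
    by (intro cSup_upper dual_norm_bdd assms) (auto intro!: exI[of _ "\<lambda>i. (1 / N x) * x i"])
  then have "\<bar>\<phi> x\<bar> / N x \<le> dual_norm V N \<phi>"
    using dual_spaceD(2)[OF assms(2,3), of "1 / N x"] pos by simp
  then show ?thesis using pos by (simp add: field_simps)
qed

lemma dual_norm_le:
  assumes "normed_on V N" "0 \<le> C" "\<And>x. x \<in> V \<Longrightarrow> \<bar>\<phi> x\<bar> \<le> C * N x"
  shows "dual_norm V N \<phi> \<le> C"
  unfolding dual_norm_def
proof (rule cSup_least)
  have "N (\<lambda>i. 0) = 0" using normed_onD(1,5)[OF assms(1)] by blast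
  then show "{\<bar>\<phi> x\<bar> | x. x \<in> V \<and> N x \<le> 1} \<noteq> {}" using normed_onD(1)[OF assms(1)] by force
next
  fix t assume "t \<in> {\<bar>\<phi> x\<bar> | x. x \<in> V \<and> N x \<le> 1}"
  then obtain x where x: "x \<in> V" "N x \<le> 1" "t = \<bar>\<phi> x\<bar>" by blast
  have "C * N x \<le> C * 1" using x assms(2) by (intro mult_left_mono) auto
  then show "t \<le> C" using assms(3)[OF x(1)] x(3) by simp
qed

lemma normed_on_dual:
  assumes V: "normed_on V N"
  shows "normed_on (dual_space V N) (dual_norm V N)"
proof -
  have zero: "(\<lambda>x. 0) \<in> dual_space V N" by (rule dual_spaceI[where C = 0]) auto
  have add: "(\<lambda>x. \<phi> x + \<psi> x) \<in> dual_space V N \<and>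
      dual_norm V N (\<lambda>x. \<phi> x + \<psi> x) \<le> dual_norm V N \<phi> + dual_norm V N \<psi>"
    if "\<phi> \<in> dual_space V N" "\<psi> \<in> dual_space V N" for \<phi> \<psi>
  proof -
    have b: "\<bar>\<phi> x + \<psi> x\<bar> \<le> (dual_norm V N \<phi> + dual_norm V N \<psi>) * N x" if "x \<in> V" for x
      using dual_norm_bound[OF V \<open>\<phi> \<in> _\<close> that] dual_norm_bound[OF V \<open>\<psi> \<in> _\<close> that]
      by (simp add: algebra_simps)
    show ?thesis
    proof
      show "(\<lambda>x. \<phi> x + \<psi> x) \<in> dual_space V N"
        by (rule dual_spaceI[OF _ _ b])
          (use dual_spaceD[OF that(1)] dual_spaceD[OF that(2)] in \<open>auto simp: algebra_simps\<close>)
      show "dual_norm V N (\<lambda>x. \<phi> x + \<psi> x) \<le> dual_norm V N \<phi> + dual_norm V N \<psi>"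
        using b dual_norm_nonneg[OF V that(1)] dual_norm_nonneg[OF V that(2)]
        by (intro dual_norm_le[OF V]) auto
    qed
  qed
  have scale: "(\<lambda>x. c * \<phi> x) \<in> dual_space V N \<and>
      dual_norm V N (\<lambda>x. c * \<phi> x) \<le> \<bar>c\<bar> * dual_norm V N \<phi>"
    if "\<phi> \<in> dual_space V N" for c \<phi>
  proof -
    have b: "\<bar>c * \<phi> x\<bar> \<le> (\<bar>c\<bar> * dual_norm V N \<phi>) * N x" if "x \<in> V" for x
      using mult_left_mono[OF dual_norm_bound[OF V \<open>\<phi> \<in> _\<close> that], of "\<bar>c\<bar>"]
      by (simp add: abs_mult mult.assoc)
    show ?thesis
    proof
      show "(\<lambda>x. c * \<phi> x) \<in> dual_space V N"
        by (rule dual_spaceI[OF _ _ b])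
          (use dual_spaceD[OF that(1)] in \<open>auto simp: algebra_simps\<close>)
      show "dual_norm V N (\<lambda>x. c * \<phi> x) \<le> \<bar>c\<bar> * dual_norm V N \<phi>"
        using b dual_norm_nonneg[OF V that(1)] by (intro dual_norm_le[OF V]) auto
    qed
  qed
  have homogeneous: "dual_norm V N (\<lambda>x. c * \<phi> x) = \<bar>c\<bar> * dual_norm V N \<phi>"
    if "\<phi> \<in> dual_space V N" for c \<phi>
  proof (cases "c = 0")
    case True
    then show ?thesis
      using scale[OF that, of 0] dual_norm_nonneg[OF V zero] by simp
  next
    case False
    have "dual_norm V N \<phi> \<le> \<bar>1 / c\<bar> * dual_norm V N (\<lambda>x. c * \<phi> x)"
      using scale[of "\<lambda>x. c * \<phi> x" "1 / c"] scale[OF that, of c] False by simp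
    then have "\<bar>c\<bar> * dual_norm V N \<phi> \<le> dual_norm V N (\<lambda>x. c * \<phi> x)"
      using False by (simp add: field_simps)
    then show ?thesis using scale[OF that, of c] by simp
  qed
  have definite: "dual_norm V N \<phi> = 0 \<longleftrightarrow> \<phi> = (\<lambda>x. 0)" if "\<phi> \<in> dual_space V N" for \<phi>
  proof
    assume "dual_norm V N \<phi> = 0"
    then have "\<phi> x = 0" for x
      using dual_norm_bound[OF V that, of x] dual_spaceD(4)[OF that, of x] by (cases "x \<in> V") auto
    then show "\<phi> = (\<lambda>x. 0)" by blast
  next
    assume "\<phi> = (\<lambda>x. 0)"
    then show "dual_norm V N \<phi> = 0" using homogeneous[OF that, of 0] by simp
  qed
  show ?thesis
    unfolding normed_on_def using zero add scale homogeneous definite dual_norm_nonneg[OF V] by blast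
qed

text \<open>
  The limit of a Cauchy sequence of functionals is taken pointwise; the Cauchy estimates pass to the
  limit because they are uniform on bounded sets.
\<close>

lemma banach_on_dual:
  assumes V: "normed_on V N"
  shows "banach_on (dual_space V N) (dual_norm V N)"
  unfolding banach_on_def
proof (intro conjI allI impI, rule normed_on_dual[OF V])
  fix s :: "nat \<Rightarrow> ('a \<Rightarrow> real) \<Rightarrow> real"
  assume "(\<forall>n. s n \<in> dual_space V N) \<and>
    (\<forall>e>0. \<exists>K. \<forall>m\<ge>K. \<forall>n\<ge>K. dual_norm V N (\<lambda>i. s m i - s n i) < e)"
  then have s: "\<And>n. s n \<in> dual_space V N"
    and cauchy: "\<And>e. e > 0 \<Longrightarrow> \<exists>K. \<forall>m\<ge>K. \<forall>n\<ge>K. dual_norm V N (\<lambda>i. s m i - s n i) < e" by auto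
  have diff: "(\<lambda>i. s m i - s n i) \<in> dual_space V N" for m n
    by (rule normed_on_diff[OF normed_on_dual[OF V] s s])
  have close: "\<exists>K. \<forall>m\<ge>K. \<forall>n\<ge>K. \<forall>x\<in>V. \<bar>s m x - s n x\<bar> \<le> e * N x" if e: "e > 0" for e
  proof -
    obtain K where K: "\<And>m n. m \<ge> K \<Longrightarrow> n \<ge> K \<Longrightarrow> dual_norm V N (\<lambda>i. s m i - s n i) < e"
      using cauchy[OF e] by blast
    have "\<bar>s m x - s n x\<bar> \<le> e * N x" if "m \<ge> K" "n \<ge> K" "x \<in> V" for m n x
      using dual_norm_bound[OF V diff that(3), of m n] normed_onD(4)[OF V that(3)]
        mult_right_mono[OF less_imp_le[OF K[OF that(1,2)]]] by force
    then show ?thesis by blast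
  qed
  have conv: "convergent (\<lambda>n. s n x)" for x
  proof (cases "x \<in> V")
    case True
    have "Cauchy (\<lambda>n. s n x)"
    proof (rule metric_CauchyI)
      fix e :: real assume e: "e > 0"
      have N: "N x \<ge> 0" using normed_onD(4)[OF V True] .
      have "e / (N x + 1) > 0" using e N by simp
      from close[OF this] obtain K
        where K: "\<And>m n. m \<ge> K \<Longrightarrow> n \<ge> K \<Longrightarrow> \<bar>s m x - s n x\<bar> \<le> e / (N x + 1) * N x"
        using True by blast
      have "e / (N x + 1) * N x < e" using e N by (simp add: field_simps)
      then show "\<exists>K. \<forall>m\<ge>K. \<forall>n\<ge>K. dist (s m x) (s n x) < e"
        using K by (force simp: dist_real_def)
    qed
    then show ?thesis using Cauchy_convergent by blast
  next
    case False
    then show ?thesis using dual_spaceD(4)[OF s] by (simp add: convergent_const)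
  qed
  define \<phi> where "\<phi> x = lim (\<lambda>n. s n x)" for x
  have lim: "(\<lambda>n. s n x) \<longlonglongrightarrow> \<phi> x" for x
    using conv[of x] unfolding \<phi>_def by (simp add: convergent_LIMSEQ_iff)
  have close_lim: "\<exists>K. \<forall>n\<ge>K. \<forall>x\<in>V. \<bar>s n x - \<phi> x\<bar> \<le> e * N x" if e: "e > 0" for e
  proof -
    obtain K where K: "\<forall>m\<ge>K. \<forall>n\<ge>K. \<forall>x\<in>V. \<bar>s m x - s n x\<bar> \<le> e * N x" using close[OF e] by blast
    have "\<bar>s n x - \<phi> x\<bar> \<le> e * N x" if "n \<ge> K" "x \<in> V" for n x
    proof (rule tendsto_upperbound)
      show "(\<lambda>m. \<bar>s n x - s m x\<bar>) \<longlonglongrightarrow> \<bar>s n x - \<phi> x\<bar>" by (intro tendsto_intros lim)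
      show "\<forall>\<^sub>F m in sequentially. \<bar>s n x - s m x\<bar> \<le> e * N x"
        using eventually_ge_at_top[of K] by eventually_elim (use K that in auto)
    qed auto
    then show ?thesis by blast
  qed
  have \<phi>: "\<phi> \<in> dual_space V N"
  proof -
    obtain K where K: "\<forall>n\<ge>K. \<forall>x\<in>V. \<bar>s n x - \<phi> x\<bar> \<le> 1 * N x"
      using close_lim[of 1] by auto
    show ?thesis
    proof (rule dual_spaceI[where C = "1 + dual_norm V N (s K)"])
      fix x y assume xy: "x \<in> V" "y \<in> V"
      have "(\<lambda>n. s n x + s n y) \<longlonglongrightarrow> \<phi> x + \<phi> y" by (intro tendsto_intros lim)
      then show "\<phi> (\<lambda>i. x i + y i) = \<phi> x + \<phi> y"
        using LIMSEQ_unique lim[of "\<lambda>i. x i + y i"] dual_spaceD(1)[OF s xy] by auto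
    next
      fix c x assume x: "x \<in> V"
      have "(\<lambda>n. c * s n x) \<longlonglongrightarrow> c * \<phi> x" by (intro tendsto_intros lim)
      then show "\<phi> (\<lambda>i. c * x i) = c * \<phi> x"
        using LIMSEQ_unique lim[of "\<lambda>i. c * x i"] dual_spaceD(2)[OF s x] by auto
    next
      fix x assume x: "x \<in> V"
      show "\<bar>\<phi> x\<bar> \<le> (1 + dual_norm V N (s K)) * N x"
        using K x dual_norm_bound[OF V s x, of K] by (force simp: algebra_simps)
    next
      fix x assume x: "x \<notin> V"
      show "\<phi> x = 0" using lim[of x] dual_spaceD(4)[OF s x] by (simp add: LIMSEQ_const_iff)
    qed
  qed
  have "(\<lambda>n. dual_norm V N (\<lambda>i. s n i - \<phi> i)) \<longlonglongrightarrow> 0"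
  proof (rule LIMSEQ_I)
    fix e :: real assume e: "e > 0"
    then obtain K where K: "\<forall>n\<ge>K. \<forall>x\<in>V. \<bar>s n x - \<phi> x\<bar> \<le> e / 2 * N x"
      using close_lim[of "e / 2"] by auto
    have "dual_norm V N (\<lambda>i. s n i - \<phi> i) \<le> e / 2" if "n \<ge> K" for n
      using K that e by (intro dual_norm_le[OF V]) auto
    moreover have "dual_norm V N (\<lambda>i. s n i - \<phi> i) \<ge> 0" for n
      by (intro dual_norm_nonneg[OF V] normed_on_diff[OF normed_on_dual[OF V] s \<phi>])
    ultimately show "\<exists>K. \<forall>n\<ge>K. norm (dual_norm V N (\<lambda>i. s n i - \<phi> i) - 0) < e"
      using e by (force intro!: exI[of _ K])
  qed
  then show "\<exists>\<phi>\<in>dual_space V N. (\<lambda>n. dual_norm V N (\<lambda>i. s n i - \<phi> i)) \<longlonglongrightarrow> 0"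
    using \<phi> by blast
qed

lemma banach_on_isometric:
  assumes V: "normed_on V N" and T: "isometric_isomorphism V N W M T" and W: "banach_on W M"
  shows "banach_on V N"
  unfolding banach_on_def
proof (intro conjI allI impI, rule V)
  fix s :: "nat \<Rightarrow> 'a \<Rightarrow> real"
  assume s: "(\<forall>n. s n \<in> V) \<and> (\<forall>e>0. \<exists>K. \<forall>m\<ge>K. \<forall>n\<ge>K. N (\<lambda>i. s m i - s n i) < e)"
  have bij: "bij_betw T V W"
    and add: "\<And>x y. x \<in> V \<Longrightarrow> y \<in> V \<Longrightarrow> T (\<lambda>i. x i + y i) = (\<lambda>i. T x i + T y i)"
    and scale: "\<And>c x. x \<in> V \<Longrightarrow> T (\<lambda>i. c * x i) = (\<lambda>i. c * T x i)"
    and iso: "\<And>x. x \<in> V \<Longrightarrow> M (T x) = N x"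
    using T unfolding isometric_isomorphism_def by blast+
  have diff: "M (\<lambda>i. T x i - T y i) = N (\<lambda>i. x i - y i)" if "x \<in> V" "y \<in> V" for x y
    using add[OF that(1) normed_onD(3)[OF V that(2), of "-1"]] scale[OF that(2), of "-1"]
      iso[OF normed_on_diff[OF V that]] by simp
  have "\<exists>w\<in>W. (\<lambda>n. M (\<lambda>i. T (s n) i - w i)) \<longlonglongrightarrow> 0"
    using W s bij unfolding banach_on_def by (simp add: diff bij_betw_apply)
  then obtain x where x: "x \<in> V" and lim: "(\<lambda>n. M (\<lambda>i. T (s n) i - T x i)) \<longlonglongrightarrow> 0"
    using bij unfolding bij_betw_def by blast
  have "(\<lambda>n. N (\<lambda>i. s n i - x i)) \<longlonglongrightarrow> 0"
    using lim s x by (simp add: diff)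
  then show "\<exists>x\<in>V. (\<lambda>n. N (\<lambda>i. s n i - x i)) \<longlonglongrightarrow> 0" using x by blast
qed

section \<open>Dual pairs of sequence spaces\<close>

abbreviation finitely_supported :: "('a \<Rightarrow> real) \<Rightarrow> bool" where
  "finitely_supported x \<equiv> finite {l. x l \<noteq> 0}"

lemma infsum_finite_support:
  fixes f :: "'a \<Rightarrow> real"
  assumes "finite F" "\<And>l. l \<notin> F \<Longrightarrow> f l = 0"
  shows "infsum f UNIV = sum f F" and "f summable_on UNIV"
  using assms has_sum_finite_neutralI[of F UNIV f "sum f F"]
  by (auto simp: infsumI summable_on_def)

text \<open>
  Two spaces of sequences in duality: the pairing is bounded by the product of the norms, and each
  norm is the least constant that bounds the pairing with finitely supported elements of the other
  space. The assumptions are invariant under exchanging the two spaces, so each result below has a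
  mirror image.
\<close>

locale dual_pair =
  fixes X :: "(int \<Rightarrow> real) set" and N :: "(int \<Rightarrow> real) \<Rightarrow> real"
    and Y :: "(int \<Rightarrow> real) set" and M :: "(int \<Rightarrow> real) \<Rightarrow> real"
  assumes finitely_supported_X: "finitely_supported x \<Longrightarrow> x \<in> X"
    and finitely_supported_Y: "finitely_supported y \<Longrightarrow> y \<in> Y"
    and N_nonneg: "x \<in> X \<Longrightarrow> 0 \<le> N x"
    and M_nonneg: "y \<in> Y \<Longrightarrow> 0 \<le> M y"
    and pair_le: "x \<in> X \<Longrightarrow> y \<in> Y \<Longrightarrow> finite F \<Longrightarrow> (\<Sum>l\<in>F. \<bar>x l * y l\<bar>) \<le> N x * M y"
    and X_norming: "0 \<le> C \<Longrightarrow>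
      (\<And>y. finitely_supported y \<Longrightarrow> \<bar>\<Sum>\<^sub>\<infinity>l. x l * y l\<bar> \<le> C * M y) \<Longrightarrow> x \<in> X \<and> N x \<le> C"
    and Y_norming: "0 \<le> C \<Longrightarrow>
      (\<And>x. finitely_supported x \<Longrightarrow> \<bar>\<Sum>\<^sub>\<infinity>l. x l * y l\<bar> \<le> C * N x) \<Longrightarrow> y \<in> Y \<and> M y \<le> C"
    and X_approx: "x \<in> X \<Longrightarrow> 0 < e \<Longrightarrow> \<exists>z. finitely_supported z \<and> N (\<lambda>l. x l - z l) < e"
    and Y_approx: "y \<in> Y \<Longrightarrow> 0 < e \<Longrightarrow> \<exists>z. finitely_supported z \<and> M (\<lambda>l. y l - z l) < e"
begin

lemma swap: "dual_pair Y M X N"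
proof unfold_locales
  fix x y F assume "x \<in> Y" "y \<in> X" "finite (F :: int set)"
  then show "(\<Sum>l\<in>F. \<bar>x l * y l\<bar>) \<le> M x * N y" using pair_le[of y x F] by (simp add: mult.commute)
next
  fix C x assume "0 \<le> C" "\<And>y. finitely_supported y \<Longrightarrow> \<bar>\<Sum>\<^sub>\<infinity>l. x l * y l\<bar> \<le> C * N y"
  then show "x \<in> Y \<and> M x \<le> C" by (intro Y_norming) (auto simp: mult.commute)
next
  fix C x assume "0 \<le> C" "\<And>y. finitely_supported y \<Longrightarrow> \<bar>\<Sum>\<^sub>\<infinity>l. y l * x l\<bar> \<le> C * M y"
  then show "x \<in> X \<and> N x \<le> C" by (intro X_norming) (auto simp: mult.commute)
qed (use finitely_supported_X finitely_supported_Y N_nonneg M_nonneg X_approx Y_approx in auto)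

lemma
  assumes "x \<in> X" "y \<in> Y"
  shows pair_summable: "(\<lambda>l. x l * y l) summable_on UNIV"
    and abs_pair_le: "\<bar>\<Sum>\<^sub>\<infinity>l. x l * y l\<bar> \<le> N x * M y"
proof -
  have abs: "(\<lambda>l. norm (x l * y l)) summable_on UNIV"
    unfolding abs_summable_iff_bdd_above
    by (rule bdd_aboveI2[where M = "N x * M y"]) (use pair_le[OF assms] in auto)
  then show "(\<lambda>l. x l * y l) summable_on UNIV" by (rule abs_summable_summable)
  have "\<bar>\<Sum>\<^sub>\<infinity>l. x l * y l\<bar> \<le> (\<Sum>\<^sub>\<infinity>l. \<bar>x l * y l\<bar>)"
    using norm_infsum_bound[OF abs] by simp
  also have "\<dots> \<le> N x * M y"
    using abs pair_le[OF assms] by (intro infsum_le_finite_sums) auto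
  finally show "\<bar>\<Sum>\<^sub>\<infinity>l. x l * y l\<bar> \<le> N x * M y" .
qed

text \<open>
  By \<open>X_norming\<close>, \<open>N x\<close> is a supremum of absolute values of linear functionals of \<open>x\<close>, which makes it
  subadditive and homogeneous; it is definite because the unit sequences are among the functionals.
\<close>

lemma normed_on_X: "normed_on X N"
proof -
  have zero: "(\<lambda>l. 0) \<in> X" by (rule finitely_supported_X) simp
  have add: "(\<lambda>l. x l + y l) \<in> X \<and> N (\<lambda>l. x l + y l) \<le> N x + N y" if "x \<in> X" "y \<in> X" for x y
  proof (rule X_norming)
    show "0 \<le> N x + N y" using N_nonneg that by simp
    fix z :: "int \<Rightarrow> real" assume "finitely_supported z"
    then have z: "z \<in> Y" by (rule finitely_supported_Y)
    have "(\<Sum>\<^sub>\<infinity>l. (x l + y l) * z l) = (\<Sum>\<^sub>\<infinity>l. x l * z l) + (\<Sum>\<^sub>\<infinity>l. y l * z l)"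
      using pair_summable that z by (simp add: algebra_simps infsum_add)
    then show "\<bar>\<Sum>\<^sub>\<infinity>l. (x l + y l) * z l\<bar> \<le> (N x + N y) * M z"
      using abs_pair_le[OF that(1) z] abs_pair_le[OF that(2) z] by (simp add: algebra_simps)
  qed
  have scale: "(\<lambda>l. c * x l) \<in> X \<and> N (\<lambda>l. c * x l) \<le> \<bar>c\<bar> * N x" if "x \<in> X" for c x
  proof (rule X_norming)
    show "0 \<le> \<bar>c\<bar> * N x" using N_nonneg that by simp
    fix z :: "int \<Rightarrow> real" assume "finitely_supported z"
    then have z: "z \<in> Y" by (rule finitely_supported_Y)
    have "(\<Sum>\<^sub>\<infinity>l. c * x l * z l) = c * (\<Sum>\<^sub>\<infinity>l. x l * z l)"
      by (simp add: mult.assoc infsum_cmult_right')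
    then show "\<bar>\<Sum>\<^sub>\<infinity>l. c * x l * z l\<bar> \<le> \<bar>c\<bar> * N x * M z"
      using mult_left_mono[OF abs_pair_le[OF that z], of "\<bar>c\<bar>"] by (simp add: abs_mult mult.assoc)
  qed
  have homogeneous: "N (\<lambda>l. c * x l) = \<bar>c\<bar> * N x" if "x \<in> X" for c x
  proof (cases "c = 0")
    case True
    then show ?thesis using scale[OF that, of 0] N_nonneg[OF zero] by simp
  next
    case False
    have "N x \<le> \<bar>1 / c\<bar> * N (\<lambda>l. c * x l)"
      using scale[of "\<lambda>l. c * x l" "1 / c"] scale[OF that, of c] False by simp
    then have "\<bar>c\<bar> * N x \<le> N (\<lambda>l. c * x l)" using False by (simp add: field_simps)
    then show ?thesis using scale[OF that, of c] by simp
  qed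
  have definite: "N x = 0 \<longleftrightarrow> x = (\<lambda>l. 0)" if "x \<in> X" for x
  proof
    assume N: "N x = 0"
    have "x l = 0" for l
    proof -
      have "(\<lambda>m. if m = l then 1 else 0) \<in> Y" by (rule finitely_supported_Y) simp
      from pair_le[OF that this, of "{l}"] show ?thesis using N by simp
    qed
    then show "x = (\<lambda>l. 0)" by blast
  next
    assume "x = (\<lambda>l. 0)"
    then show "N x = 0" using homogeneous[OF that, of 0] by simp
  qed
  show ?thesis
    unfolding normed_on_def using zero add scale homogeneous definite N_nonneg by blast
qed

text \<open>
  A bounded functional \<open>\<phi>\<close> on \<open>X\<close> is represented by its values \<open>y l\<close> on the unit sequences: on
  finitely supported \<open>x\<close> the pairing with \<open>y\<close> is \<open>\<phi> x\<close>, so \<open>Y_norming\<close> puts \<open>y\<close> into \<open>Y\<close>, and density of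
  the finitely supported sequences extends the identity to \<open>X\<close>.
\<close>

lemma pairing_isometric:
  "isometric_isomorphism Y M (dual_space X N) (dual_norm X N) (pairing_functional X)"
proof -
  note nX = normed_on_X
  have app: "pairing_functional X y x = (\<Sum>\<^sub>\<infinity>l. x l * y l)" if "x \<in> X" for x y
    using that by (simp add: pairing_functional_def)
  have dual: "pairing_functional X y \<in> dual_space X N" if y: "y \<in> Y" for y
  proof (rule dual_spaceI[where C = "M y"])
    fix u v assume "u \<in> X" "v \<in> X"
    then show "pairing_functional X y (\<lambda>i. u i + v i)
        = pairing_functional X y u + pairing_functional X y v"
      using normed_onD(2)[OF nX] pair_summable y by (simp add: app algebra_simps infsum_add)
  next
    fix c u assume "u \<in> X"
    then show "pairing_functional X y (\<lambda>i. c * u i) = c * pairing_functional X y u"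
      using normed_onD(3)[OF nX] by (simp add: app mult.assoc infsum_cmult_right')
  next
    fix u assume "u \<in> X"
    then show "\<bar>pairing_functional X y u\<bar> \<le> M y * N u"
      using abs_pair_le[OF _ y] by (simp add: app mult.commute)
  qed (simp add: pairing_functional_def)
  have norm: "dual_norm X N (pairing_functional X y) = M y" if y: "y \<in> Y" for y
  proof (rule antisym)
    show "dual_norm X N (pairing_functional X y) \<le> M y"
      using abs_pair_le[OF _ y] M_nonneg[OF y]
      by (intro dual_norm_le[OF nX]) (auto simp: app mult.commute)
    have "y \<in> Y \<and> M y \<le> dual_norm X N (pairing_functional X y)"
    proof (rule Y_norming[OF dual_norm_nonneg[OF nX dual[OF y]]])
      fix x :: "int \<Rightarrow> real" assume "finitely_supported x"
      then have "x \<in> X" by (rule finitely_supported_X)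
      then show "\<bar>\<Sum>\<^sub>\<infinity>l. x l * y l\<bar> \<le> dual_norm X N (pairing_functional X y) * N x"
        using dual_norm_bound[OF nX dual[OF y]] app by metis
    qed
    then show "M y \<le> dual_norm X N (pairing_functional X y)" by simp
  qed
  define e :: "int \<Rightarrow> int \<Rightarrow> real" where "e l = (\<lambda>m. if m = l then 1 else 0)" for l
  have eX: "e l \<in> X" for l by (rule finitely_supported_X) (simp add: e_def)
  have coord: "pairing_functional X y (e l) = y l" for y l
    unfolding app[OF eX] by (subst infsum_finite_support[where F = "{l}"]) (auto simp: e_def)
  have inj: "inj_on (pairing_functional X) Y"
    by (rule inj_onI) (metis coord ext)
  have surj: "\<phi> \<in> pairing_functional X ` Y" if \<phi>: "\<phi> \<in> dual_space X N" for \<phi>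
  proof -
    define y where "y l = \<phi> (e l)" for l
    have fin: "\<phi> x = (\<Sum>\<^sub>\<infinity>l. x l * y l)" if x: "finitely_supported x" for x
    proof -
      have part: "\<phi> (\<lambda>m. if m \<in> F then x m else 0) = (\<Sum>l\<in>F. x l * y l)" if "finite F" for F
        using that
      proof induction
        case empty
        show ?case using dual_spaceD(2)[OF \<phi> normed_onD(1)[OF nX], of 0] by simp
      next
        case (insert l F)
        have FX: "(\<lambda>m. if m \<in> F then x m else 0) \<in> X"
          using insert(1) by (intro finitely_supported_X) (auto intro: rev_finite_subset)
        have "(\<lambda>m. if m \<in> insert l F then x m else 0)
            = (\<lambda>m. x l * e l m + (if m \<in> F then x m else 0))"
          using insert(2) by (auto simp: e_def)
        then show ?case
          using dual_spaceD(1)[OF \<phi> normed_onD(3)[OF nX eX, of "x l"] FX]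
            dual_spaceD(2)[OF \<phi> eX, of "x l"] insert by (simp add: y_def)
      qed
      have "(\<lambda>m. if m \<in> {l. x l \<noteq> 0} then x m else 0) = x" by auto
      then have "\<phi> x = (\<Sum>l | x l \<noteq> 0. x l * y l)" using part[OF x] by simp
      then show ?thesis using infsum_finite_support(1)[OF x, of "\<lambda>l. x l * y l"] by simp
    qed
    have y: "y \<in> Y"
      using Y_norming[OF dual_norm_nonneg[OF nX \<phi>]] fin finitely_supported_X
        dual_norm_bound[OF nX \<phi>] by metis
    define \<psi> where "\<psi> = (\<lambda>x. \<phi> x - pairing_functional X y x)"
    have \<psi>: "\<psi> \<in> dual_space X N"
      unfolding \<psi>_def by (rule normed_on_diff[OF normed_on_dual[OF nX] \<phi> dual[OF y]])
    have \<psi>0: "\<psi> z = 0" if "finitely_supported z" for z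
      unfolding \<psi>_def using fin[OF that] app[OF finitely_supported_X[OF that]] by simp
    \<comment> \<open>A bounded functional that vanishes on a dense subspace vanishes.\<close>
    have "\<psi> x = 0" if x: "x \<in> X" for x
    proof (rule ccontr)
      assume "\<psi> x \<noteq> 0"
      define D where "D = dual_norm X N \<psi> + 1"
      have D: "D > 0" "dual_norm X N \<psi> \<le> D"
        using dual_norm_nonneg[OF nX \<psi>] by (auto simp: D_def)
      obtain z where z: "finitely_supported z" "N (\<lambda>l. x l - z l) < \<bar>\<psi> x\<bar> / D"
        using X_approx[OF x, of "\<bar>\<psi> x\<bar> / D"] \<open>\<psi> x \<noteq> 0\<close> D by auto
      have zX: "z \<in> X" by (rule finitely_supported_X[OF z(1)])
      note dX = normed_on_diff[OF nX x zX]
      have "\<bar>\<psi> x\<bar> = \<bar>\<psi> (\<lambda>l. x l - z l)\<bar>"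
        using dual_space_diff[OF nX \<psi> x zX] \<psi>0[OF z(1)] by simp
      also have "\<dots> \<le> D * N (\<lambda>l. x l - z l)"
        using dual_norm_bound[OF nX \<psi> dX] mult_right_mono[OF D(2) N_nonneg[OF dX]] by linarith
      also have "\<dots> < D * (\<bar>\<psi> x\<bar> / D)" using z(2) D(1) by (rule mult_strict_left_mono)
      finally show False using D(1) by simp
    qed
    then have "\<phi> x = pairing_functional X y x" for x
      using dual_spaceD(4)[OF \<phi>, of x] by (cases "x \<in> X") (auto simp: \<psi>_def pairing_functional_def)
    then show ?thesis using y by blast
  qed
  have "bij_betw (pairing_functional X) Y (dual_space X N)"
    unfolding bij_betw_def using inj surj dual by blast
  moreover have "pairing_functional X (\<lambda>i. y i + z i)
      = (\<lambda>x. pairing_functional X y x + pairing_functional X z x)" if "y \<in> Y" "z \<in> Y" for y z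
    using pair_summable that
    by (auto simp: pairing_functional_def fun_eq_iff distrib_left infsum_add)
  moreover have "pairing_functional X (\<lambda>i. c * y i) = (\<lambda>x. c * pairing_functional X y x)" for c y
    by (auto simp: pairing_functional_def fun_eq_iff mult.left_commute[of _ c] infsum_cmult_right')
  ultimately show ?thesis unfolding isometric_isomorphism_def using norm by blast
qed

text \<open>
  \<open>Y\<close> is isometric to a dual space.
\<close>

lemma banach_on_Y: "banach_on Y M"
  by (rule banach_on_isometric[OF dual_pair.normed_on_X[OF swap] pairing_isometric
        banach_on_dual[OF normed_on_X]])

lemma predual_and_dualities:
  "is_predual Y M X N
    \<and> isometric_isomorphism Y M (dual_space X N) (dual_norm X N) (pairing_functional X)
    \<and> isometric_isomorphism X N (dual_space Y M) (dual_norm Y M) (pairing_functional Y)"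
  unfolding is_predual_def
  using banach_on_Y dual_pair.banach_on_Y[OF swap] pairing_isometric
    dual_pair.pairing_isometric[OF swap] by blast

end

section \<open>Inequalities and sums\<close>

text \<open>
  Young's inequality for the two families normalised to norm \<open>1\<close>, summed over \<open>A\<close>.
\<close>

lemma Holder_sum:
  fixes f g :: "'a \<Rightarrow> real"
  assumes "1 < p" "1 < p'" "1 / p + 1 / p' = 1"
  shows "(\<Sum>l\<in>A. \<bar>f l * g l\<bar>)
    \<le> (\<Sum>l\<in>A. \<bar>f l\<bar> powr p) powr (1 / p) * (\<Sum>l\<in>A. \<bar>g l\<bar> powr p') powr (1 / p')"
proof (cases "finite A")
  case True
  define a where "a = (\<Sum>l\<in>A. \<bar>f l\<bar> powr p) powr (1 / p)"
  define b where "b = (\<Sum>l\<in>A. \<bar>g l\<bar> powr p') powr (1 / p')"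
  have ap: "a powr p = (\<Sum>l\<in>A. \<bar>f l\<bar> powr p)" and bp: "b powr p' = (\<Sum>l\<in>A. \<bar>g l\<bar> powr p')"
    using assms by (simp_all add: a_def b_def powr_powr sum_nonneg)
  show ?thesis
  proof (cases "a = 0 \<or> b = 0")
    case True
    then have "(\<forall>l\<in>A. f l = 0) \<or> (\<forall>l\<in>A. g l = 0)"
      using \<open>finite A\<close> by (simp add: a_def b_def sum_nonneg_eq_0_iff)
    then have "(\<Sum>l\<in>A. \<bar>f l * g l\<bar>) = 0" by (intro sum.neutral) auto
    then show ?thesis by simp
  next
    case False
    then have pos: "a > 0" "b > 0" by (auto simp: a_def b_def)
    have "(\<Sum>l\<in>A. \<bar>f l * g l\<bar>) / (a * b) = (\<Sum>l\<in>A. (\<bar>f l\<bar> / a) * (\<bar>g l\<bar> / b))"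
      by (simp add: sum_divide_distrib abs_mult)
    also have "\<dots> \<le> (\<Sum>l\<in>A. (\<bar>f l\<bar> / a) powr p / p + (\<bar>g l\<bar> / b) powr p' / p')"
      using assms pos by (intro sum_mono Youngs_inequality) auto
    also have "\<dots> = (\<Sum>l\<in>A. \<bar>f l\<bar> powr p) / a powr p / p + (\<Sum>l\<in>A. \<bar>g l\<bar> powr p') / b powr p' / p'"
      using pos by (simp add: sum.distrib powr_divide sum_divide_distrib)
    also have "\<dots> = 1" using assms pos by (simp flip: ap bp)
    finally have "(\<Sum>l\<in>A. \<bar>f l * g l\<bar>) \<le> a * b" using pos by (simp add: field_simps)
    then show ?thesis by (simp add: a_def b_def)
  qed
qed simp

lemma bounded_sums_summable:
  fixes f :: "'a \<Rightarrow> real"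
  assumes "\<And>i. 0 \<le> f i" "\<And>A. finite A \<Longrightarrow> sum f A \<le> C"
  shows "f summable_on UNIV" and "infsum f UNIV \<le> C"
proof -
  show s: "f summable_on UNIV"
    by (rule nonneg_bdd_above_summable_on) (use assms in \<open>auto intro!: bdd_aboveI2[where M = C]\<close>)
  show "infsum f UNIV \<le> C" using infsum_le_finite_sums[OF s] assms by blast
qed

lemma summable_on_finite_sum:
  fixes f :: "'l \<Rightarrow> 'a \<Rightarrow> real"
  assumes "finite F" "\<And>l. (\<lambda>i. f l i) summable_on A"
  shows "(\<lambda>i. \<Sum>l\<in>F. f l i) summable_on A"
  using assms by (induction F rule: finite_induct) (auto intro: summable_on_add)

lemma summable_tail_small:
  fixes f :: "'a \<Rightarrow> real"
  assumes "f summable_on UNIV" "\<And>i. 0 \<le> f i" "0 < e"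
  obtains J where "finite J" "\<And>A. finite A \<Longrightarrow> A \<inter> J = {} \<Longrightarrow> sum f A \<le> e"
proof -
  obtain J where J: "finite J" "dist (sum f J) (infsum f UNIV) \<le> e"
    using infsum_finite_approximation[OF assms(1,3)] by auto
  have "sum f A \<le> e" if A: "finite A" "A \<inter> J = {}" for A
  proof -
    have "sum f (A \<union> J) \<le> infsum f UNIV"
      using A J assms by (intro finite_sum_le_infsum) auto
    then show ?thesis using A J by (simp add: sum.union_disjoint dist_real_def)
  qed
  then show ?thesis using that J(1) by blast
qed

lemma lp_norm_finite_support:
  assumes "finite F" "{l. a l \<noteq> 0} \<subseteq> F" "0 < s"
  shows "lp_norm s a = (\<Sum>l\<in>F. \<bar>a l\<bar> powr s) powr (1 / s)"
  unfolding lp_norm_def using assms by (subst infsum_finite_support[of F]) auto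

lemma has_sum_l1_loc_iff: "has_sum_l1_loc f y \<longleftrightarrow> (\<forall>l. ((\<lambda>i. f i l) has_sum y l) UNIV)"
proof
  assume L: "has_sum_l1_loc f y"
  show "\<forall>l. ((\<lambda>i. f i l) has_sum y l) UNIV"
  proof
    fix l
    have "((\<lambda>S. \<Sum>l\<in>{l}. \<bar>(\<Sum>i\<in>S. f i l) - y l\<bar>) \<longlongrightarrow> 0) (finite_subsets_at_top UNIV)"
      using L unfolding has_sum_l1_loc_def by blast
    then have "((\<lambda>S. (\<Sum>i\<in>S. f i l) - y l) \<longlongrightarrow> 0) (finite_subsets_at_top UNIV)"
      by (simp add: tendsto_rabs_zero_iff)
    then show "((\<lambda>i. f i l) has_sum y l) UNIV" unfolding has_sum_def using LIM_zero_iff by blast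
  qed
next
  assume R: "\<forall>l. ((\<lambda>i. f i l) has_sum y l) UNIV"
  have "((\<lambda>S. \<bar>(\<Sum>i\<in>S. f i l) - y l\<bar>) \<longlongrightarrow> 0) (finite_subsets_at_top UNIV)" for l
    using R LIM_zero unfolding has_sum_def by (intro tendsto_rabs_zero) blast
  then show "has_sum_l1_loc f y"
    unfolding has_sum_l1_loc_def by (intro allI impI tendsto_null_sum) auto
qed

section \<open>Compactness of boxes and differentiation of powers\<close>

text \<open>
  Tychonoff's theorem, for the product topology that function types carry.
\<close>

lemma compact_box:
  fixes B :: "'a \<Rightarrow> 'b::topological_space set"
  assumes "\<And>i. compact (B i)"
  shows "compact {x. \<forall>i. x i \<in> B i}"
proof -
  have "compactin (product_topology (\<lambda>i. euclidean) UNIV) (PiE UNIV B)"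
    unfolding compactin_PiE using assms by simp
  moreover have "PiE UNIV B = {x. \<forall>i. x i \<in> B i}" by (auto simp: PiE_UNIV_domain)
  ultimately show ?thesis by (simp add: euclidean_product_topology)
qed

text \<open>
  At \<open>u = 0\<close> the difference quotient has absolute value \<open>\<bar>h\<bar> powr (s - 1)\<close>, which tends to \<open>0\<close> because
  \<open>1 < s\<close>.
\<close>

lemma DERIV_abs_powr:
  fixes s u :: real
  assumes s: "1 < s"
  shows "((\<lambda>t. \<bar>t\<bar> powr s) has_real_derivative s * (\<bar>u\<bar> powr (s - 1) * sgn u)) (at u)"
proof (cases u "0 :: real" rule: linorder_cases)
  case less
  have "((\<lambda>t. (- t) powr s) has_real_derivative s * (\<bar>u\<bar> powr (s - 1) * sgn u)) (at u)"
    using less by (auto intro!: derivative_eq_intros)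
  then show ?thesis
    by (rule has_field_derivative_transform_within_open[of _ _ _ "{..<0}"]) (use less in auto)
next
  case greater
  have "((\<lambda>t. t powr s) has_real_derivative s * (\<bar>u\<bar> powr (s - 1) * sgn u)) (at u)"
    using greater by (auto intro!: derivative_eq_intros)
  then show ?thesis
    by (rule has_field_derivative_transform_within_open[of _ _ _ "{0<..}"]) (use greater in auto)
next
  case equal
  have "continuous_on UNIV (\<lambda>h::real. \<bar>h\<bar> powr (s - 1))"
    using s by (intro continuous_on_powr' continuous_intros) auto
  then have "isCont (\<lambda>h::real. \<bar>h\<bar> powr (s - 1)) 0"
    by (simp add: continuous_on_eq_continuous_at)
  then have "((\<lambda>h::real. \<bar>h\<bar> powr (s - 1)) \<longlongrightarrow> 0) (at 0)"
    using s by (simp add: isCont_def)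
  moreover have "\<bar>\<bar>h\<bar> powr s / h\<bar> = \<bar>h\<bar> powr (s - 1)" if "h \<noteq> 0" for h :: real
    using that by (simp add: abs_divide powr_diff)
  ultimately have "((\<lambda>h::real. \<bar>\<bar>h\<bar> powr s / h\<bar>) \<longlongrightarrow> 0) (at 0)"
    by (subst tendsto_cong[where g = "\<lambda>h. \<bar>h\<bar> powr (s - 1)"]) (auto simp: eventually_at_filter)
  then have "((\<lambda>h::real. \<bar>h\<bar> powr s / h) \<longlongrightarrow> 0) (at 0)"
    by (rule tendsto_rabs_zero_cancel)
  then show ?thesis using s equal by (simp add: DERIV_def)
qed

section \<open>Mixed-norm spaces over a weighted cover\<close>

text \<open>
  Dyadic intervals enter the proof only through the following properties: a cover of the integers by
  finite sets \<open>S i\<close> with weights \<open>w i\<close>. Summability of the weights at each point says that the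
  unit sequences have finite mixed norm; by Hoelder it also makes every series of weighted atoms
  converge at each point.
\<close>

locale weighted_cover =
  fixes S :: "'i \<Rightarrow> int set" and w :: "'i \<Rightarrow> real" and p p' r r' :: real
  assumes p_gt: "1 < p" and p'_gt: "1 < p'" and conj_p: "1 / p + 1 / p' = 1"
    and r_gt: "1 < r" and r'_gt: "1 < r'" and conj_r: "1 / r + 1 / r' = 1"
    and finite_S: "finite (S i)" and w_pos: "0 < w i"
    and covered: "\<exists>i. l \<in> S i"
    and weights_summable: "(\<lambda>i. w i powr r) summable_on {i. l \<in> S i}"
begin

definition energy :: "(int \<Rightarrow> real) \<Rightarrow> 'i \<Rightarrow> real" where
  "energy x i = (\<Sum>l\<in>S i. \<bar>x l\<bar> powr p)"

definition mixed_term :: "(int \<Rightarrow> real) \<Rightarrow> 'i \<Rightarrow> real" where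
  "mixed_term x i = w i powr r * energy x i powr (r / p)"

definition mixed_space :: "(int \<Rightarrow> real) set" where
  "mixed_space = {x. mixed_term x summable_on UNIV}"

definition mixed_norm :: "(int \<Rightarrow> real) \<Rightarrow> real" where
  "mixed_norm x = (\<Sum>\<^sub>\<infinity>i. mixed_term x i) powr (1 / r)"

text \<open>
  The blocks, with the weight \<open>w i\<close> as normalisation.
\<close>

definition atom :: "'i \<Rightarrow> (int \<Rightarrow> real) \<Rightarrow> bool" where
  "atom i a \<longleftrightarrow> {l. a l \<noteq> 0} \<subseteq> S i \<and> lp_norm p' a \<le> w i"

definition atomic_rep :: "(int \<Rightarrow> real) \<Rightarrow> ('i \<Rightarrow> real) \<Rightarrow> ('i \<Rightarrow> int \<Rightarrow> real) \<Rightarrow> bool" where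
  "atomic_rep y c a \<longleftrightarrow>
     c \<in> lp_space r' \<and> (\<forall>i. atom i (a i)) \<and> has_sum_l1_loc (\<lambda>i l. c i * a i l) y"

definition atomic_space :: "(int \<Rightarrow> real) set" where
  "atomic_space = {y. \<exists>c a. atomic_rep y c a}"

definition atomic_norm :: "(int \<Rightarrow> real) \<Rightarrow> real" where
  "atomic_norm y = Inf {lp_norm r' c | c a. atomic_rep y c a}"

definition local_norm :: "(int \<Rightarrow> real) \<Rightarrow> 'i \<Rightarrow> real" where
  "local_norm a i = (\<Sum>l\<in>S i. \<bar>a l\<bar> powr p') powr (1 / p')"

lemma energy_nonneg: "0 \<le> energy x i"
  by (simp add: energy_def sum_nonneg)

lemma mixed_term_nonneg: "0 \<le> mixed_term x i"
  by (simp add: mixed_term_def)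

text \<open>
  The mixed norm of \<open>x\<close> is the \<open>\<ell>\<^sup>r\<close> norm of this family; in this form it meets Hoelder's inequality.
\<close>

lemma mixed_term_root: "mixed_term x i powr (1 / r) = w i * energy x i powr (1 / p)"
  using r_gt w_pos[of i] by (simp add: mixed_term_def powr_mult powr_powr)

lemma partial_mixed_norm_le:
  assumes "x \<in> mixed_space" "finite A"
  shows "(\<Sum>i\<in>A. mixed_term x i) powr (1 / r) \<le> mixed_norm x"
  unfolding mixed_norm_def using assms r_gt mixed_term_nonneg
  by (intro powr_mono2 finite_sum_le_infsum sum_nonneg) (auto simp: mixed_space_def)

lemma partial_lp_norm_le:
  assumes "c \<in> lp_space r'" "finite A"
  shows "(\<Sum>i\<in>A. \<bar>c i\<bar> powr r') powr (1 / r') \<le> lp_norm r' c"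
  unfolding lp_norm_def using assms r'_gt
  by (intro powr_mono2 finite_sum_le_infsum sum_nonneg) (auto simp: lp_space_def)

lemma atom_local_norm:
  assumes "{l. a l \<noteq> 0} \<subseteq> S i"
  shows "lp_norm p' a = local_norm a i"
  unfolding local_norm_def using lp_norm_finite_support[OF finite_S assms] p'_gt by simp

lemma atom_pair_le:
  assumes "atom i a" "finite F"
  shows "(\<Sum>l\<in>F. \<bar>x l * a l\<bar>) \<le> mixed_term x i powr (1 / r)"
proof -
  have supp: "{l. a l \<noteq> 0} \<subseteq> S i" using assms(1) by (simp add: atom_def)
  have "(\<Sum>l\<in>F. \<bar>x l * a l\<bar>) = (\<Sum>l\<in>F \<inter> S i. \<bar>x l * a l\<bar>)"
    using assms(2) supp by (intro sum.mono_neutral_right) auto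
  also have "\<dots> \<le> (\<Sum>l\<in>S i. \<bar>x l * a l\<bar>)" using finite_S by (intro sum_mono2) auto
  also have "\<dots> \<le> energy x i powr (1 / p) * local_norm a i"
    unfolding energy_def local_norm_def by (rule Holder_sum[OF p_gt p'_gt conj_p])
  also have "\<dots> \<le> energy x i powr (1 / p) * w i"
    using assms(1) atom_local_norm[OF supp] by (intro mult_left_mono) (auto simp: atom_def)
  finally show ?thesis by (simp add: mixed_term_root mult.commute)
qed

text \<open>
  Finite partial sums of the representation satisfy the bound by Hoelder on each \<open>S i\<close> and then
  over the indices; the bound survives the limit because it does not depend on the partial sum.
\<close>

lemma atomic_rep_pair_le:
  assumes x: "x \<in> mixed_space" and y: "atomic_rep y c a" and F: "finite F"
  shows "(\<Sum>l\<in>F. \<bar>x l * y l\<bar>) \<le> mixed_norm x * lp_norm r' c"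
proof (rule tendsto_upperbound)
  show "((\<lambda>A. \<Sum>l\<in>F. \<bar>x l * (\<Sum>i\<in>A. c i * a i l)\<bar>) \<longlongrightarrow> (\<Sum>l\<in>F. \<bar>x l * y l\<bar>))
      (finite_subsets_at_top UNIV)"
    using y unfolding atomic_rep_def has_sum_l1_loc_iff has_sum_def by (intro tendsto_intros) auto
  have "(\<Sum>l\<in>F. \<bar>x l * (\<Sum>i\<in>A. c i * a i l)\<bar>) \<le> mixed_norm x * lp_norm r' c" if A: "finite A" for A
  proof -
    have "(\<Sum>l\<in>F. \<bar>x l * (\<Sum>i\<in>A. c i * a i l)\<bar>) \<le> (\<Sum>l\<in>F. \<Sum>i\<in>A. \<bar>c i\<bar> * \<bar>x l * a i l\<bar>)"
    proof (rule sum_mono)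
      fix l
      have "\<bar>x l * (\<Sum>i\<in>A. c i * a i l)\<bar> = \<bar>\<Sum>i\<in>A. c i * (x l * a i l)\<bar>"
        by (simp add: sum_distrib_left mult.left_commute)
      also have "\<dots> \<le> (\<Sum>i\<in>A. \<bar>c i * (x l * a i l)\<bar>)" by (rule sum_abs)
      finally show "\<bar>x l * (\<Sum>i\<in>A. c i * a i l)\<bar> \<le> (\<Sum>i\<in>A. \<bar>c i\<bar> * \<bar>x l * a i l\<bar>)"
        by (simp add: abs_mult)
    qed
    also have "\<dots> = (\<Sum>i\<in>A. \<bar>c i\<bar> * (\<Sum>l\<in>F. \<bar>x l * a i l\<bar>))"
      by (subst sum.swap) (simp add: sum_distrib_left)
    also have "\<dots> \<le> (\<Sum>i\<in>A. \<bar>mixed_term x i powr (1 / r) * c i\<bar>)"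
    proof (rule sum_mono)
      fix i
      have "atom i (a i)" using y by (simp add: atomic_rep_def)
      from mult_left_mono[OF atom_pair_le[OF this F, of x], of "\<bar>c i\<bar>"]
      show "\<bar>c i\<bar> * (\<Sum>l\<in>F. \<bar>x l * a i l\<bar>) \<le> \<bar>mixed_term x i powr (1 / r) * c i\<bar>"
        by (simp add: abs_mult mult.commute)
    qed
    also have "\<dots> \<le> (\<Sum>i\<in>A. \<bar>mixed_term x i powr (1 / r)\<bar> powr r) powr (1 / r)
        * (\<Sum>i\<in>A. \<bar>c i\<bar> powr r') powr (1 / r')"
      by (rule Holder_sum[OF r_gt r'_gt conj_r])
    also have "\<dots> = (\<Sum>i\<in>A. mixed_term x i) powr (1 / r) * (\<Sum>i\<in>A. \<bar>c i\<bar> powr r') powr (1 / r')"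
      using r_gt mixed_term_nonneg by (simp add: powr_powr)
    also have "\<dots> \<le> mixed_norm x * lp_norm r' c"
      using partial_mixed_norm_le[OF x A] partial_lp_norm_le[OF _ A] y
      by (intro mult_mono) (auto simp: atomic_rep_def mixed_norm_def)
    finally show ?thesis .
  qed
  then show "\<forall>\<^sub>F A in finite_subsets_at_top UNIV.
      (\<Sum>l\<in>F. \<bar>x l * (\<Sum>i\<in>A. c i * a i l)\<bar>) \<le> mixed_norm x * lp_norm r' c"
    by (intro eventually_finite_subsets_at_top_weakI) auto
qed simp

lemma atomic_norm_lower:
  assumes "y \<in> atomic_space" "\<And>c a. atomic_rep y c a \<Longrightarrow> t \<le> lp_norm r' c"
  shows "t \<le> atomic_norm y"
  unfolding atomic_norm_def using assms
  by (intro cInf_greatest) (auto simp: atomic_space_def)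

lemma lp_norm_nonneg: "0 \<le> lp_norm s c"
  by (simp add: lp_norm_def)

lemma atomic_norm_upper:
  assumes "atomic_rep y c a"
  shows "atomic_norm y \<le> lp_norm r' c"
  unfolding atomic_norm_def using assms lp_norm_nonneg
  by (intro cInf_lower bdd_belowI[where m = 0]) auto

lemma mixed_atomic_pair_le:
  assumes x: "x \<in> mixed_space" and y: "y \<in> atomic_space" and F: "finite F"
  shows "(\<Sum>l\<in>F. \<bar>x l * y l\<bar>) \<le> mixed_norm x * atomic_norm y"
proof (cases "mixed_norm x = 0")
  case True
  obtain c a where "atomic_rep y c a" using y by (auto simp: atomic_space_def)
  from atomic_rep_pair_le[OF x this F] True show ?thesis by simp
next
  case False
  then have pos: "mixed_norm x > 0" by (simp add: mixed_norm_def order_le_neq_trans)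
  have "(\<Sum>l\<in>F. \<bar>x l * y l\<bar>) / mixed_norm x \<le> atomic_norm y"
  proof (rule atomic_norm_lower[OF y])
    fix c a assume "atomic_rep y c a"
    from atomic_rep_pair_le[OF x this F]
    show "(\<Sum>l\<in>F. \<bar>x l * y l\<bar>) / mixed_norm x \<le> lp_norm r' c"
      using pos by (simp add: pos_divide_le_eq mult.commute[of "lp_norm r' c"])
  qed
  then show ?thesis using pos by (simp add: field_simps)
qed

lemma local_norm_eq_0:
  assumes "{l. b l \<noteq> 0} \<subseteq> S i" "local_norm b i = 0"
  shows "b l = 0"
  using assms finite_S[of i] p'_gt
  by (cases "l \<in> S i") (auto simp: local_norm_def sum_nonneg_eq_0_iff)

lemma local_norm_scale: "local_norm (\<lambda>l. c * b l) i = \<bar>c\<bar> * local_norm b i"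
  using p'_gt
  by (simp add: local_norm_def abs_mult powr_mult powr_powr sum_nonneg flip: sum_distrib_left)

text \<open>
  Every atomic representation is produced through this lemma: a decomposition of \<open>y\<close> into pieces
  \<open>b i\<close> becomes one after dividing the pieces by their size \<open>\<beta> i\<close>. A piece of size \<open>0\<close> vanishes, so it
  does not matter that \<open>inverse 0 = 0\<close>.
\<close>

lemma atomic_spaceI:
  assumes supp: "\<And>i. {l. b i l \<noteq> 0} \<subseteq> S i" and \<beta>: "\<And>i. 0 \<le> \<beta> i"
    and b: "\<And>i. local_norm (b i) i \<le> w i * \<beta> i"
    and B: "0 \<le> B" "\<And>A. finite A \<Longrightarrow> (\<Sum>i\<in>A. \<beta> i powr r') \<le> B powr r'"
    and y: "\<And>l. ((\<lambda>i. b i l) has_sum y l) UNIV"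
  shows "y \<in> atomic_space" and "atomic_norm y \<le> B"
proof -
  define a where "a i l = inverse (\<beta> i) * b i l" for i l
  have ba: "\<beta> i * a i l = b i l" for i l
  proof (cases "\<beta> i = 0")
    case True
    moreover have "0 \<le> local_norm (b i) i" by (simp add: local_norm_def)
    ultimately have "local_norm (b i) i = 0" using b[of i] by simp
    then show ?thesis using local_norm_eq_0[OF supp] True by simp
  qed (simp add: a_def)
  have "atom i (a i)" for i
  proof -
    have s: "{l. a i l \<noteq> 0} \<subseteq> S i" using supp[of i] by (auto simp: a_def)
    have "local_norm (a i) i = inverse (\<beta> i) * local_norm (b i) i"
      unfolding a_def using local_norm_scale \<beta>[of i] by simp
    also have "\<dots> \<le> inverse (\<beta> i) * (w i * \<beta> i)"
      using b \<beta>[of i] by (intro mult_left_mono) auto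
    also have "\<dots> \<le> w i" using w_pos[of i] by (cases "\<beta> i = 0") auto
    finally show ?thesis using s atom_local_norm[OF s] by (simp add: atom_def)
  qed
  moreover note \<beta>_sum = bounded_sums_summable[of "\<lambda>i. \<bar>\<beta> i\<bar> powr r'" "B powr r'"]
  moreover have "\<beta> \<in> lp_space r'"
    unfolding lp_space_def using \<beta>_sum(1) \<beta> B(2) by simp
  ultimately have rep: "atomic_rep y \<beta> a"
    unfolding atomic_rep_def has_sum_l1_loc_iff using y ba by simp
  then show "y \<in> atomic_space" by (auto simp: atomic_space_def)
  have "lp_norm r' \<beta> \<le> (B powr r') powr (1 / r')"
    unfolding lp_norm_def using \<beta>_sum(2) \<beta> B(2) r'_gt
    by (intro powr_mono2) (auto intro!: infsum_nonneg)
  also have "\<dots> = B" using r'_gt B(1) by (simp add: powr_powr)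
  finally show "atomic_norm y \<le> B" using atomic_norm_upper[OF rep] by simp
qed

text \<open>
  The factor \<open>1/r\<close> times the gradient of \<open>mixed_term\<close> (see \<open>gradient_mixed_term\<close>); it is at once the
  extremal function for Hoelder's inequality on \<open>S i\<close>. Where \<open>energy x i = 0\<close> it vanishes,
  as \<open>x\<close> does on \<open>S i\<close>.
\<close>

definition duality_map :: "(int \<Rightarrow> real) \<Rightarrow> 'i \<Rightarrow> int \<Rightarrow> real" where
  "duality_map x i l = (if l \<in> S i
     then w i powr r * energy x i powr (r / p - 1) * \<bar>x l\<bar> powr (p - 1) * sgn (x l) else 0)"

lemma energy_eq_0: "energy x i = 0 \<longleftrightarrow> (\<forall>l\<in>S i. x l = 0)"
  using finite_S p_gt by (simp add: energy_def sum_nonneg_eq_0_iff)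

lemma powr_self_mult: "0 \<le> t \<Longrightarrow> t powr (s - 1) * t = t powr s" for t s :: real
  by (cases "t = 0") (auto simp: powr_mult_base powr_diff)

lemma duality_map_pair: "(\<Sum>l\<in>S i. x l * duality_map x i l) = mixed_term x i"
proof -
  have "x l * (\<bar>x l\<bar> powr (p - 1) * sgn (x l)) = \<bar>x l\<bar> powr p" for l
    using powr_self_mult[of "\<bar>x l\<bar>" p] abs_sgn[of "x l"] by (simp add: mult.left_commute)
  then have "x l * duality_map x i l
      = w i powr r * energy x i powr (r / p - 1) * \<bar>x l\<bar> powr p" if "l \<in> S i" for l
    using that by (simp add: duality_map_def mult.left_commute mult.assoc)
  then have "(\<Sum>l\<in>S i. x l * duality_map x i l)
      = w i powr r * (energy x i powr (r / p - 1) * energy x i)"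
    unfolding energy_def by (simp add: sum_distrib_left mult.assoc)
  then show ?thesis by (simp add: powr_self_mult[OF energy_nonneg] mixed_term_def)
qed

text \<open>
  With \<open>duality_map_pair\<close> this is the equality case of Hoelder: the pairing \<open>mixed_term x i\<close> is the
  product of \<open>mixed_term x i powr (1 / r)\<close> and \<open>mixed_term x i powr (1 / r')\<close>.
\<close>

lemma duality_map_norm: "local_norm (duality_map x i) i = w i * mixed_term x i powr (1 / r')"
proof -
  define E where "E = energy x i"
  have E: "E \<ge> 0" by (simp add: E_def energy_nonneg)
  have p1: "(p - 1) * p' = p"
    using conj_p p_gt p'_gt by (auto simp: field_simps)
  have p2: "r / p - 1 + 1 / p' = (r - 1) / p"
    using conj_p by (simp add: diff_divide_distrib)
  have r1: "r / r' = r - 1" and r2: "r / (p * r') = (r - 1) / p"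
    using conj_r r_gt r'_gt p_gt by (simp_all add: field_simps)
  have "\<bar>duality_map x i l\<bar> powr p' = (w i powr r * E powr (r / p - 1)) powr p' * \<bar>x l\<bar> powr p"
    if "l \<in> S i" for l
  proof -
    have "\<bar>duality_map x i l\<bar> = (w i powr r * E powr (r / p - 1)) * \<bar>x l\<bar> powr (p - 1)"
      using that by (cases "x l = 0") (auto simp: duality_map_def abs_mult E_def)
    then show ?thesis by (simp add: powr_mult powr_powr p1)
  qed
  then have "local_norm (duality_map x i) i
      = ((w i powr r * E powr (r / p - 1)) powr p' * E) powr (1 / p')"
    unfolding local_norm_def by (simp add: E_def energy_def sum_distrib_left)
  also have "\<dots> = w i powr r * (E powr (r / p - 1) * E powr (1 / p'))"
    using p'_gt E by (simp add: powr_mult powr_powr)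
  also have "\<dots> = w i powr r * E powr ((r - 1) / p)"
    by (simp add: p2 flip: powr_add)
  also have "\<dots> = w i * (w i powr (r - 1) * E powr ((r - 1) / p))"
    using powr_self_mult[of "w i" r] w_pos[of i] by (simp add: mult.commute mult.left_commute)
  also have "w i powr (r - 1) * E powr ((r - 1) / p) = mixed_term x i powr (1 / r')"
    using E w_pos[of i] by (simp add: mixed_term_def E_def powr_mult powr_powr r1 r2)
  finally show ?thesis .
qed

lemma duality_map_support: "{l. duality_map x i l \<noteq> 0} \<subseteq> S i"
  by (auto simp: duality_map_def)

text \<open>
  Test against the sum \<open>y\<close> of the duality maps over a finite set \<open>J\<close>. With \<open>T\<close> the sum of the mixed
  terms over \<open>J\<close>, the pairing is \<open>T\<close> and the norm of \<open>y\<close> is at most \<open>T powr (1 / r')\<close>, so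
  \<open>T powr (1 / r) \<le> C\<close>.
\<close>

lemma mixed_space_norming:
  assumes C: "0 \<le> C"
    and le: "\<And>y. finitely_supported y \<Longrightarrow> \<bar>\<Sum>\<^sub>\<infinity>l. x l * y l\<bar> \<le> C * atomic_norm y"
  shows "x \<in> mixed_space \<and> mixed_norm x \<le> C"
proof -
  have part: "(\<Sum>i\<in>J. mixed_term x i) \<le> C powr r" if J: "finite J" for J
  proof -
    define T where "T = (\<Sum>i\<in>J. mixed_term x i)"
    have T0: "T \<ge> 0" unfolding T_def by (intro sum_nonneg mixed_term_nonneg)
    define y where "y l = (\<Sum>i\<in>J. duality_map x i l)" for l
    define U where "U = (\<Union>i\<in>J. S i)"
    have U: "finite U" unfolding U_def using J finite_S by blast
    have yU: "y l = 0" if "l \<notin> U" for l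
      unfolding y_def using that by (intro sum.neutral) (auto simp: U_def duality_map_def)
    have fin: "finitely_supported y"
      by (rule finite_subset[OF _ U]) (use yU in auto)
    have "(\<Sum>\<^sub>\<infinity>l. x l * y l) = (\<Sum>l\<in>U. x l * y l)"
      by (rule infsum_finite_support(1)[OF U]) (simp add: yU)
    also have "\<dots> = (\<Sum>i\<in>J. \<Sum>l\<in>U. x l * duality_map x i l)"
      unfolding y_def sum_distrib_left by (rule sum.swap)
    also have "\<dots> = (\<Sum>i\<in>J. \<Sum>l\<in>S i. x l * duality_map x i l)"
      by (intro sum.cong refl sum.mono_neutral_right U) (auto simp: U_def duality_map_def)
    also have "\<dots> = T" by (simp add: duality_map_pair T_def)
    finally have T: "T \<le> C * atomic_norm y" using le[OF fin] by linarith
    have "atomic_norm y \<le> T powr (1 / r')"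
    proof (rule atomic_spaceI(2)[where b = "\<lambda>i l. if i \<in> J then duality_map x i l else 0"
          and \<beta> = "\<lambda>i. if i \<in> J then mixed_term x i powr (1 / r') else 0"])
      show "((\<lambda>i. if i \<in> J then duality_map x i l else 0) has_sum y l) UNIV" for l
        unfolding y_def by (rule has_sum_finite_neutralI[OF J]) auto
      fix A :: "'i set" assume A: "finite A"
      have "(\<Sum>i\<in>A. (if i \<in> J then mixed_term x i powr (1 / r') else 0) powr r')
          = (\<Sum>i\<in>A. if i \<in> J then mixed_term x i else 0)"
        using r'_gt mixed_term_nonneg by (intro sum.cong) (auto simp: powr_powr)
      also have "\<dots> = (\<Sum>i\<in>A \<inter> J. mixed_term x i)" using A by (simp add: sum.inter_restrict)
      also have "\<dots> \<le> T" unfolding T_def using J mixed_term_nonneg by (intro sum_mono2) auto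
      also have "T = (T powr (1 / r')) powr r'" using T0 r'_gt by (simp add: powr_powr)
      finally show "(\<Sum>i\<in>A. (if i \<in> J then mixed_term x i powr (1 / r') else 0) powr r')
        \<le> (T powr (1 / r')) powr r'" .
    next
      show "local_norm (\<lambda>l. if i \<in> J then duality_map x i l else 0) i
        \<le> w i * (if i \<in> J then mixed_term x i powr (1 / r') else 0)" for i
        by (cases "i \<in> J") (auto simp: duality_map_norm, simp add: local_norm_def)
    qed (use duality_map_support in auto)
    then have T1: "T \<le> C * T powr (1 / r')"
      using T C mult_left_mono by fastforce
    have "T powr (1 / r) \<le> C"
    proof (cases "T = 0")
      case False
      then have pos: "T > 0" using T0 by simp
      have "T powr (1 / r) * T powr (1 / r') = T" using conj_r pos by (simp flip: powr_add)
      then show ?thesis using T1 pos by (metis mult_le_cancel_right_pos powr_gt_zero less_irrefl)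
    qed (use C in simp)
    then have "(T powr (1 / r)) powr r \<le> C powr r" using r_gt by (intro powr_mono2) auto
    then show ?thesis using T0 r_gt by (simp add: powr_powr T_def)
  qed
  note sums = bounded_sums_summable[of "mixed_term x", OF mixed_term_nonneg part]
  have "mixed_norm x \<le> (C powr r) powr (1 / r)"
    unfolding mixed_norm_def using sums(2) r_gt
    by (intro powr_mono2) (auto intro: infsum_nonneg mixed_term_nonneg)
  then show ?thesis using sums(1) C r_gt by (simp add: mixed_space_def powr_powr)
qed

text \<open>
  Only indices with \<open>S i\<close> meeting the support contribute, and their contributions are dominated by
  the summable weights.
\<close>

lemma finitely_supported_mixed:
  assumes x: "finitely_supported x"
  shows "x \<in> mixed_space"
proof -
  define F where "F = {l. x l \<noteq> 0}"
  have F: "finite F" using x by (simp add: F_def)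
  define K where "K = (\<Sum>l\<in>F. \<bar>x l\<bar> powr p) powr (r / p)"
  have "(\<lambda>i. if l \<in> S i then w i powr r else 0) summable_on UNIV" for l
    using weights_summable[of l] by (rule summable_on_cong_neutral[THEN iffD1, rotated -1]) auto
  then have dom: "(\<lambda>i. (\<Sum>l\<in>F. if l \<in> S i then w i powr r else 0) * K) summable_on UNIV"
    by (intro summable_on_cmult_left summable_on_finite_sum F)
  have "mixed_term x i \<le> (\<Sum>l\<in>F. if l \<in> S i then w i powr r else 0) * K" for i
  proof (cases "F \<inter> S i = {}")
    case True
    then have "energy x i = 0" unfolding energy_eq_0 by (auto simp: F_def)
    then show ?thesis using r_gt by (auto simp: mixed_term_def K_def intro!: mult_nonneg_nonneg sum_nonneg)
  next
    case False
    then obtain l where l: "l \<in> F" "l \<in> S i" by blast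
    have "energy x i = (\<Sum>l\<in>F \<inter> S i. \<bar>x l\<bar> powr p)"
      unfolding energy_def using finite_S by (intro sum.mono_neutral_right) (auto simp: F_def)
    also have "\<dots> \<le> (\<Sum>l\<in>F. \<bar>x l\<bar> powr p)" using F by (intro sum_mono2) auto
    finally have E: "energy x i powr (r / p) \<le> K"
      unfolding K_def using r_gt p_gt energy_nonneg by (intro powr_mono2) auto
    have "w i powr r \<le> (\<Sum>l\<in>F. if l \<in> S i then w i powr r else 0)"
      using member_le_sum[OF l(1), of "\<lambda>l. if l \<in> S i then w i powr r else 0"] F l(2) by simp
    then show ?thesis unfolding mixed_term_def using E by (intro mult_mono) (auto intro!: sum_nonneg)
  qed
  then show ?thesis
    unfolding mixed_space_def using summable_on_comparison_test[OF dom] mixed_term_nonneg by auto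
qed

text \<open>
  Each point of the support is assigned to one member of the cover that contains it.
\<close>

lemma finitely_supported_atomic:
  assumes y: "finitely_supported y"
  shows "y \<in> atomic_space"
proof -
  define F where "F = {l. y l \<noteq> 0}"
  have F: "finite F" using y by (simp add: F_def)
  obtain \<iota> where \<iota>: "\<And>l. l \<in> S (\<iota> l)" using covered by metis
  define b where "b i l = (if \<iota> l = i then y l else 0)" for i l
  define \<beta> where "\<beta> i = local_norm (b i) i / w i" for i
  define B where "B = (\<Sum>i\<in>\<iota> ` F. \<beta> i powr r') powr (1 / r')"
  have supp: "{l. b i l \<noteq> 0} \<subseteq> S i" for i using \<iota> by (auto simp: b_def)
  have \<beta>0: "\<beta> i = 0" if "i \<notin> \<iota> ` F" for i
  proof -
    have "b i l = 0" for l using that by (auto simp: b_def F_def)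
    then show ?thesis by (simp add: \<beta>_def local_norm_def)
  qed
  have \<beta>n: "\<beta> i \<ge> 0" for i using w_pos[of i] by (simp add: \<beta>_def local_norm_def)
  show ?thesis
  proof (rule atomic_spaceI(1)[where b = b and \<beta> = \<beta> and B = B])
    fix A :: "'i set" assume A: "finite A"
    have "(\<Sum>i\<in>A. \<beta> i powr r') = (\<Sum>i\<in>A \<inter> \<iota> ` F. \<beta> i powr r')"
      using A \<beta>0 by (intro sum.mono_neutral_right) auto
    also have "\<dots> \<le> (\<Sum>i\<in>\<iota> ` F. \<beta> i powr r')" using F by (intro sum_mono2) auto
    finally show "(\<Sum>i\<in>A. \<beta> i powr r') \<le> B powr r'"
      using r'_gt by (simp add: B_def powr_powr sum_nonneg)
  next
    show "((\<lambda>i. b i l) has_sum y l) UNIV" for l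
      by (rule has_sum_finite_neutralI[of "{\<iota> l}"]) (auto simp: b_def)
    show "local_norm (b i) i \<le> w i * \<beta> i" for i using w_pos[of i] by (simp add: \<beta>_def)
  qed (use supp \<beta>n in \<open>auto simp: B_def\<close>)
qed

text \<open>
  Restricting \<open>x\<close> to the union of the \<open>S i\<close> with \<open>i\<close> in a large finite set removes the mixed terms of
  these \<open>i\<close> from the difference and increases no other.
\<close>

lemma mixed_space_approx:
  assumes x: "x \<in> mixed_space" and e: "0 < e"
  shows "\<exists>z. finitely_supported z \<and> mixed_norm (\<lambda>l. x l - z l) < e"
proof -
  have "(e / 2) powr r > 0" using e by simp
  then obtain J where J: "finite J"
    and tail: "\<And>A. finite A \<Longrightarrow> A \<inter> J = {} \<Longrightarrow> (\<Sum>i\<in>A. mixed_term x i) \<le> (e / 2) powr r"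
    using summable_tail_small[of "mixed_term x" "(e / 2) powr r"] x mixed_term_nonneg
    unfolding mixed_space_def by auto
  define U where "U = (\<Union>i\<in>J. S i)"
  define z where "z l = (if l \<in> U then x l else 0)" for l
  have U: "finite U" unfolding U_def using J finite_S by blast
  have "{l. z l \<noteq> 0} \<subseteq> U" by (auto simp: z_def)
  then have z: "finitely_supported z" by (rule finite_subset[OF _ U])
  have in_J: "mixed_term (\<lambda>l. x l - z l) i = 0" if "i \<in> J" for i
  proof -
    have "energy (\<lambda>l. x l - z l) i = 0" using that unfolding energy_eq_0 by (auto simp: z_def U_def)
    then show ?thesis using r_gt by (simp add: mixed_term_def)
  qed
  have le: "mixed_term (\<lambda>l. x l - z l) i \<le> mixed_term x i" for i
  proof -
    have "energy (\<lambda>l. x l - z l) i \<le> energy x i"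
      unfolding energy_def using p_gt by (intro sum_mono) (auto simp: z_def)
    then show ?thesis unfolding mixed_term_def using r_gt p_gt energy_nonneg
      by (intro mult_left_mono powr_mono2) auto
  qed
  have "(\<Sum>i\<in>A. mixed_term (\<lambda>l. x l - z l) i) \<le> (e / 2) powr r" if A: "finite A" for A
  proof -
    have "(\<Sum>i\<in>A. mixed_term (\<lambda>l. x l - z l) i) = (\<Sum>i\<in>A - J. mixed_term (\<lambda>l. x l - z l) i)"
      using A in_J by (intro sum.mono_neutral_right) auto
    also have "\<dots> \<le> (\<Sum>i\<in>A - J. mixed_term x i)" by (intro sum_mono le)
    also have "\<dots> \<le> (e / 2) powr r" using A by (intro tail) auto
    finally show ?thesis .
  qed
  from bounded_sums_summable(2)[OF mixed_term_nonneg this]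
  have "mixed_norm (\<lambda>l. x l - z l) \<le> ((e / 2) powr r) powr (1 / r)"
    unfolding mixed_norm_def using r_gt
    by (intro powr_mono2) (auto intro: infsum_nonneg mixed_term_nonneg)
  also have "\<dots> < e" using e r_gt by (simp add: powr_powr)
  finally show ?thesis using z by blast
qed

text \<open>
  A finite partial sum of a representation is finitely supported, and the remaining terms represent
  the difference.
\<close>

lemma atomic_space_approx:
  assumes y: "y \<in> atomic_space" and e: "0 < e"
  shows "\<exists>z. finitely_supported z \<and> atomic_norm (\<lambda>l. y l - z l) < e"
proof -
  obtain c a where rep: "atomic_rep y c a" using y by (auto simp: atomic_space_def)
  then have c: "(\<lambda>i. \<bar>c i\<bar> powr r') summable_on UNIV" and at: "\<And>i. atom i (a i)"
    and sum: "\<And>l. ((\<lambda>i. c i * a i l) has_sum y l) UNIV"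
    by (auto simp: atomic_rep_def lp_space_def has_sum_l1_loc_iff)
  have pos: "(e / 2) powr r' > 0" using e by simp
  obtain J where J: "finite J"
    and tail: "\<And>A. finite A \<Longrightarrow> A \<inter> J = {} \<Longrightarrow> (\<Sum>i\<in>A. \<bar>c i\<bar> powr r') \<le> (e / 2) powr r'"
    by (rule summable_tail_small[OF c _ pos]) auto
  have supp: "{l. a i l \<noteq> 0} \<subseteq> S i" for i using at by (simp add: atom_def)
  define z where "z l = (\<Sum>i\<in>J. c i * a i l)" for l
  have "{l. z l \<noteq> 0} \<subseteq> (\<Union>i\<in>J. S i)"
  proof
    fix l assume "l \<in> {l. z l \<noteq> 0}"
    then obtain i where "i \<in> J" "c i * a i l \<noteq> 0" unfolding z_def by (auto elim: sum.not_neutral_contains_not_neutral)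
    then show "l \<in> (\<Union>i\<in>J. S i)" using supp[of i] by auto
  qed
  then have z: "finitely_supported z" by (rule finite_subset) (use J finite_S in blast)
  have "atomic_norm (\<lambda>l. y l - z l) \<le> e / 2"
  proof (rule atomic_spaceI(2)[where b = "\<lambda>i l. if i \<in> J then 0 else c i * a i l"
        and \<beta> = "\<lambda>i. if i \<in> J then 0 else \<bar>c i\<bar>"])
    fix A :: "'i set" assume A: "finite A"
    have "(\<Sum>i\<in>A. (if i \<in> J then 0 else \<bar>c i\<bar>) powr r') = (\<Sum>i\<in>A - J. \<bar>c i\<bar> powr r')"
      using A by (intro sum.mono_neutral_cong_right) auto
    also have "\<dots> \<le> (e / 2) powr r'" using A by (intro tail) auto
    finally show "(\<Sum>i\<in>A. (if i \<in> J then 0 else \<bar>c i\<bar>) powr r') \<le> (e / 2) powr r'" .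
  next
    fix l
    have "((\<lambda>i. if i \<in> J then c i * a i l else 0) has_sum z l) UNIV"
      unfolding z_def by (rule has_sum_finite_neutralI[OF J]) auto
    from has_sum_add[OF sum[of l] has_sum_uminusI[OF this]]
    have "((\<lambda>i. c i * a i l + - (if i \<in> J then c i * a i l else 0)) has_sum y l - z l) UNIV"
      by simp
    moreover have "(\<lambda>i. c i * a i l + - (if i \<in> J then c i * a i l else 0))
        = (\<lambda>i. if i \<in> J then 0 else c i * a i l)" by auto
    ultimately show "((\<lambda>i. if i \<in> J then 0 else c i * a i l) has_sum y l - z l) UNIV"
      by simp
  next
    fix i
    have "local_norm (a i) i \<le> w i" using at atom_local_norm[OF supp] by (simp add: atom_def)
    from mult_left_mono[OF this, of "\<bar>c i\<bar>"]
    show "local_norm (\<lambda>l. if i \<in> J then 0 else c i * a i l) i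
        \<le> w i * (if i \<in> J then 0 else \<bar>c i\<bar>)"
      by (cases "i \<in> J") (simp_all add: local_norm_scale mult.commute, simp add: local_norm_def)
  qed (use supp e in auto)
  then show ?thesis using z e by force
qed

section \<open>The atomic space is normed by the mixed-norm space\<close>

lemma continuous_on_mixed_term: "continuous_on UNIV (\<lambda>x. mixed_term x i)"
  unfolding mixed_term_def energy_def using p_gt r_gt
  by (intro continuous_on_powr' continuous_intros continuous_on_product_coordinates)
    (auto intro!: sum_nonneg)

lemma continuous_on_pairing: "continuous_on UNIV (\<lambda>x. \<Sum>l\<in>F. x l * y l :: real)"
  by (intro continuous_intros continuous_on_product_coordinates)

lemma closed_mixed_ball: "closed {x. (\<Sum>i\<in>J. mixed_term x i) \<le> 1}"
  by (intro closed_Collect_le continuous_on_sum continuous_on_mixed_term continuous_on_const)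

lemma mixed_term_scale: "mixed_term (\<lambda>l. c * x l) i = \<bar>c\<bar> powr r * mixed_term x i"
proof -
  have "energy (\<lambda>l. c * x l) i = \<bar>c\<bar> powr p * energy x i"
    by (simp add: energy_def abs_mult powr_mult sum_distrib_left)
  then show ?thesis using p_gt energy_nonneg
    by (simp add: mixed_term_def powr_mult powr_powr)
qed

text \<open>
  One member of the cover around \<open>l\<close> controls the coordinate \<open>x l\<close>, so bounded sets lie in boxes.
\<close>

lemma coordinate_le:
  assumes "l \<in> S i"
  shows "w i * \<bar>x l\<bar> \<le> mixed_term x i powr (1 / r)"
proof -
  have "\<bar>x l\<bar> powr p \<le> energy x i"
    unfolding energy_def using finite_S by (intro member_le_sum assms) auto
  then have "(\<bar>x l\<bar> powr p) powr (1 / p) \<le> energy x i powr (1 / p)"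
    using p_gt by (intro powr_mono2) auto
  then have "\<bar>x l\<bar> \<le> energy x i powr (1 / p)" using p_gt by (simp add: powr_powr)
  then show ?thesis unfolding mixed_term_root using w_pos[of i] by simp
qed

lemma coordinate_le_inverse_weight:
  assumes "l \<in> S i" "finite J" "i \<in> J" "(\<Sum>i\<in>J. mixed_term x i) \<le> 1"
  shows "\<bar>x l\<bar> \<le> 1 / w i"
proof -
  have "mixed_term x i \<le> 1"
    using member_le_sum[OF assms(3), of "mixed_term x"] assms mixed_term_nonneg by force
  then have "mixed_term x i powr (1 / r) \<le> 1 powr (1 / r)"
    using r_gt mixed_term_nonneg by (intro powr_mono2) auto
  then show ?thesis
    using coordinate_le[OF assms(1), of x] w_pos[of i] by (simp add: field_simps)
qed

text \<open>
  The chain rule, except where the inner sum vanishes: there \<open>mixed_term\<close> is a multiple of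
  \<open>\<bar>t\<bar> powr r\<close>, whose derivative at \<open>0\<close> is \<open>0\<close> because \<open>1 < r\<close>.
\<close>

lemma gradient_mixed_term:
  "((\<lambda>t. mixed_term (x(l := x l + t)) i) has_real_derivative r * duality_map x i l) (at 0)"
proof (cases "l \<in> S i")
  case False
  then have "energy (x(l := x l + t)) i = energy x i" for t
    unfolding energy_def by (intro sum.cong) auto
  then show ?thesis using False by (simp add: mixed_term_def duality_map_def)
next
  case True
  define R where "R = (\<Sum>m\<in>S i - {l}. \<bar>x m\<bar> powr p)"
  have R: "energy (x(l := x l + t)) i = R + \<bar>x l + t\<bar> powr p" for t
    unfolding energy_def R_def using True finite_S by (subst sum.remove[of _ l]) auto
  have E: "energy x i = R + \<bar>x l\<bar> powr p" using R[of 0] by simp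
  have D: "((\<lambda>t. R + \<bar>x l + t\<bar> powr p) has_real_derivative
      p * (\<bar>x l\<bar> powr (p - 1) * sgn (x l))) (at 0)"
  proof -
    have "((\<lambda>t. \<bar>x l + t\<bar> powr p) has_real_derivative
        p * (\<bar>x l\<bar> powr (p - 1) * sgn (x l))) (at 0)"
      using DERIV_abs_powr[OF p_gt, of "x l"]
        DERIV_shift[of "\<lambda>t. \<bar>t\<bar> powr p" "p * (\<bar>x l\<bar> powr (p - 1) * sgn (x l))" 0 "x l"]
      by (simp add: add.commute)
    from DERIV_add[OF DERIV_const[of R] this] show ?thesis by simp
  qed
  show ?thesis
  proof (cases "energy x i = 0")
    case False
    then have pos: "R + \<bar>x l + 0\<bar> powr p > 0" using energy_nonneg[of x i] E by simp
    have "((\<lambda>t. (R + \<bar>x l + t\<bar> powr p) powr (r / p)) has_real_derivative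
        r / p * (R + \<bar>x l + 0\<bar> powr p) powr (r / p - of_nat 1)
          * (p * (\<bar>x l\<bar> powr (p - 1) * sgn (x l)))) (at 0)"
      by (rule DERIV_fun_powr[OF D pos])
    note deriv = DERIV_cmult[OF this, of "w i powr r"]
    have "w i powr r * (r / p * (R + \<bar>x l + 0\<bar> powr p) powr (r / p - of_nat 1)
        * (p * (\<bar>x l\<bar> powr (p - 1) * sgn (x l)))) = r * duality_map x i l"
      using p_gt True by (simp add: duality_map_def E)
    with deriv show ?thesis by (simp only: mixed_term_def R)
  next
    case zero: True
    have xl: "x l = 0" using zero True by (simp add: energy_eq_0)
    then have R0: "R = 0" using zero E p_gt by simp
    have "((\<lambda>t. \<bar>t\<bar> powr r) has_real_derivative 0) (at 0)"
      using DERIV_abs_powr[OF r_gt, of 0] by simp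
    from DERIV_cmult[OF this, of "w i powr r"]
    have "((\<lambda>t. w i powr r * \<bar>t\<bar> powr r) has_real_derivative r * duality_map x i l) (at 0)"
      using xl by (simp add: duality_map_def)
    moreover have "mixed_term (x(l := x l + t)) i = w i powr r * \<bar>t\<bar> powr r" for t
      unfolding mixed_term_def R using xl R0 p_gt by (simp add: powr_powr)
    ultimately show ?thesis by (simp only:)
  qed
qed

text \<open>
  The finite-dimensional core. The pairing with \<open>y\<close> attains its maximum \<open>m\<close> over the unit ball of the
  sequences on \<open>F\<close> at some \<open>x\<close>. By homogeneity the pairing is at most \<open>m\<close> times the norm everywhere
  on these sequences, with equality at \<open>x\<close>, so both sides have the same gradient at \<open>x\<close>.
\<close>

lemma finite_duality:
  assumes F: "finite F" and J: "finite J" and cover: "\<And>l. l \<in> F \<Longrightarrow> \<exists>i\<in>J. l \<in> S i"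
    and le: "\<And>x. (\<And>l. l \<notin> F \<Longrightarrow> x l = 0) \<Longrightarrow> (\<Sum>i\<in>J. mixed_term x i) \<le> 1 \<Longrightarrow>
      (\<Sum>l\<in>F. x l * y l) \<le> C"
  obtains x m where "0 \<le> m" "m \<le> C" "(\<Sum>i\<in>J. mixed_term x i) \<le> 1"
    "\<And>l. l \<in> F \<Longrightarrow> y l = m * (\<Sum>i\<in>J. duality_map x i l)"
proof -
  define G where "G x = (\<Sum>i\<in>J. mixed_term x i)" for x
  define P where "P x = (\<Sum>l\<in>F. x l * y l)" for x
  have G0: "G x \<ge> 0" for x unfolding G_def by (intro sum_nonneg mixed_term_nonneg)
  have Gscale: "G (\<lambda>l. c * x l) = \<bar>c\<bar> powr r * G x" for c x
    by (simp add: G_def mixed_term_scale sum_distrib_left)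
  obtain \<iota> where \<iota>: "\<And>l. l \<in> F \<Longrightarrow> \<iota> l \<in> J \<and> l \<in> S (\<iota> l)" using cover by metis
  \<comment> \<open>The ball is compact since the members of the cover around the points of \<open>F\<close> confine it to a box.\<close>
  define Q where "Q l = (if l \<in> F then {- (1 / w (\<iota> l)) .. 1 / w (\<iota> l)} else {0})" for l
  define K where "K = {x. \<forall>l. x l \<in> Q l} \<inter> {x. G x \<le> 1}"
  have KI: "x \<in> K" if "\<And>l. l \<notin> F \<Longrightarrow> x l = 0" "G x \<le> 1" for x
  proof -
    have "x l \<in> Q l" for l
      using coordinate_le_inverse_weight[of l "\<iota> l" J x] \<iota>[of l] J that
      by (cases "l \<in> F") (auto simp: Q_def G_def abs_le_iff)
    then show ?thesis using that by (simp add: K_def)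
  qed
  have KD: "x l = 0" if "x \<in> K" "l \<notin> F" for x l
  proof -
    have "x l \<in> Q l" using that by (simp add: K_def)
    then show ?thesis using that by (simp add: Q_def)
  qed
  have compact: "compact K"
    unfolding K_def G_def
    by (intro compact_Int_closed compact_box closed_mixed_ball) (auto simp: Q_def)
  have nonempty: "K \<noteq> {}"
  proof -
    have "G (\<lambda>l. 0) = 0" using Gscale[of 0] by simp
    then show ?thesis using KI[of "\<lambda>l. 0"] by auto
  qed
  have cont: "continuous_on K P"
    unfolding P_def by (rule continuous_on_subset[OF continuous_on_pairing]) simp
  obtain x where x: "x \<in> K" and max: "\<And>z. z \<in> K \<Longrightarrow> P z \<le> P x"
    using continuous_attains_sup[OF compact nonempty cont] by blast
  define m where "m = P x"
  have Gx: "G x \<le> 1" using x by (simp add: K_def)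
  have m0: "m \<ge> 0"
  proof -
    have "G (\<lambda>l. 0) = 0" using Gscale[of 0] by simp
    then have "P (\<lambda>l. 0) \<le> m" unfolding m_def by (intro max KI) auto
    then show ?thesis by (simp add: P_def)
  qed
  have mC: "m \<le> C" unfolding m_def P_def using le[of x] KD[OF x] Gx by (simp add: G_def)
  have bound: "P z \<le> m * G z powr (1 / r)" if z: "\<And>l. l \<notin> F \<Longrightarrow> z l = 0" for z
  proof (cases "G z = 0")
    case True
    have "z l = 0" for l
    proof (cases "l \<in> F")
      case l: True
      have "mixed_term z (\<iota> l) = 0"
        using True J \<iota>[OF l] mixed_term_nonneg by (auto simp: G_def sum_nonneg_eq_0_iff)
      then show ?thesis
        using coordinate_le[of l "\<iota> l" z] \<iota>[OF l] w_pos[of "\<iota> l"] by (simp add: mult_le_0_iff)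
    qed (use z in simp)
    then have "P z = 0" by (simp add: P_def)
    then show ?thesis using True by simp
  next
    case False
    define g where "g = G z powr (1 / r)"
    have g: "g > 0" using False by (simp add: g_def)
    have gr: "g powr r = G z" using r_gt G0[of z] by (simp add: g_def powr_powr)
    have "G (\<lambda>l. (1 / g) * z l) = 1"
      unfolding Gscale using g gr False by (simp add: powr_divide)
    then have "(\<lambda>l. (1 / g) * z l) \<in> K" using z by (intro KI) auto
    then have "P (\<lambda>l. (1 / g) * z l) \<le> m" unfolding m_def by (rule max)
    moreover have "P (\<lambda>l. (1 / g) * z l) = P z / g"
      by (simp add: P_def sum_divide_distrib)
    ultimately have "P z / g \<le> m" by simp
    then show ?thesis using g by (simp add: g_def[symmetric] pos_divide_le_eq)
  qed
  have "y l = m * (\<Sum>i\<in>J. duality_map x i l)" if l: "l \<in> F" for l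
  proof (cases "m = 0")
    case True
    have "P (\<lambda>k. if k = l then y l else 0) = (\<Sum>k\<in>F. if k = l then y l * y l else 0)"
      unfolding P_def by (intro sum.cong) auto
    also have "\<dots> = y l * y l" using F l by simp
    finally have P: "P (\<lambda>k. if k = l then y l else 0) = y l * y l" .
    have "P (\<lambda>k. if k = l then y l else 0) \<le> m * G (\<lambda>k. if k = l then y l else 0) powr (1 / r)"
      by (rule bound) (use l in auto)
    then have "y l * y l \<le> 0" using P True by simp
    moreover have "y l * y l \<ge> 0" by simp
    ultimately have "y l * y l = 0" by (rule antisym)
    then show ?thesis using True by simp
  next
    case False
    then have mpos: "m > 0" using m0 by simp
    have "m * 1 \<le> m * G x powr (1 / r)" using bound[OF KD[OF x]] by (simp add: m_def)
    then have "1 \<le> G x powr (1 / r)" using mpos by (metis mult_le_cancel_left_pos)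
    moreover have "G x powr (1 / r) \<le> 1 powr (1 / r)" using Gx G0 r_gt by (intro powr_mono2) auto
    ultimately have "G x powr (1 / r) = 1" by simp
    then have "(G x powr (1 / r)) powr r = 1" by simp
    then have G1: "G x = 1" using r_gt G0[of x] by (simp add: powr_powr)
    \<comment> \<open>The function \<open>h\<close> is nonnegative and vanishes at \<open>0\<close>, so its derivative there is \<open>0\<close>.\<close>
    define h where "h t = m * G (x(l := x l + t)) powr (1 / r) - (m + t * y l)" for t
    have dG: "((\<lambda>t. G (x(l := x l + t))) has_real_derivative (\<Sum>i\<in>J. r * duality_map x i l)) (at 0)"
      unfolding G_def by (intro DERIV_sum gradient_mixed_term)
    have "((\<lambda>t. G (x(l := x l + t)) powr (1 / r)) has_real_derivative
        1 / r * G (x(l := x l + 0)) powr (1 / r - of_nat 1) * (\<Sum>i\<in>J. r * duality_map x i l)) (at 0)"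
      by (rule DERIV_fun_powr[OF dG]) (simp add: G1)
    then have "((\<lambda>t. G (x(l := x l + t)) powr (1 / r)) has_real_derivative
        (\<Sum>i\<in>J. duality_map x i l)) (at 0)"
      using r_gt by (simp add: G1 flip: sum_distrib_left)
    moreover have "((\<lambda>t. m + t * y l) has_real_derivative y l) (at 0)"
      by (auto intro!: derivative_eq_intros)
    ultimately have deriv: "(h has_real_derivative m * (\<Sum>i\<in>J. duality_map x i l) - y l) (at 0)"
      unfolding h_def by (intro DERIV_diff DERIV_cmult)
    have "h 0 \<le> h t" for t
    proof -
      have "P (x(l := x l + t)) = (\<Sum>k\<in>F. x k * y k + (if k = l then t * y l else 0))"
        unfolding P_def by (intro sum.cong) (auto simp: algebra_simps)
      also have "\<dots> = m + t * y l" using F l by (simp add: sum.distrib m_def P_def)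
      finally have "P (x(l := x l + t)) = m + t * y l" .
      moreover have "P (x(l := x l + t)) \<le> m * G (x(l := x l + t)) powr (1 / r)"
        by (rule bound) (use KD[OF x] l in auto)
      ultimately show ?thesis by (simp add: h_def G1)
    qed
    then have "m * (\<Sum>i\<in>J. duality_map x i l) - y l = 0"
      by (intro DERIV_local_min[OF deriv zero_less_one]) simp
    then show ?thesis by simp
  qed
  then show ?thesis using that m0 mC Gx unfolding G_def by blast
qed

text \<open>
  The unit balls for larger and larger finite index sets decrease to the unit ball for the full
  norm, on which the pairing is at most \<open>C\<close>. If the pairing took values above \<open>C + e\<close> on each of them,
  compactness would give a point of the full unit ball where it is at least \<open>C + e\<close>.
\<close>

lemma finite_subfamily_suffices:
  assumes F: "finite F" and C: "0 \<le> C" and e: "0 < e"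
    and le: "\<And>x. finitely_supported x \<Longrightarrow> \<bar>\<Sum>\<^sub>\<infinity>l. x l * y l\<bar> \<le> C * mixed_norm x"
  obtains J where "finite J" "\<And>l. l \<in> F \<Longrightarrow> \<exists>i\<in>J. l \<in> S i"
    "\<And>x. (\<And>l. l \<notin> F \<Longrightarrow> x l = 0) \<Longrightarrow> (\<Sum>i\<in>J. mixed_term x i) \<le> 1 \<Longrightarrow>
      (\<Sum>l\<in>F. x l * y l) \<le> C + e"
proof -
  obtain \<iota> where \<iota>: "\<And>l. l \<in> S (\<iota> l)" using covered by metis
  define Q where "Q l = (if l \<in> F then {- (1 / w (\<iota> l)) .. 1 / w (\<iota> l)} else {0})" for l
  define K where "K = {x. \<forall>l. x l \<in> Q l}"
  define Z where "Z J = {x. (\<Sum>i\<in>J. mixed_term x i) \<le> 1} \<inter> {x. C + e \<le> (\<Sum>l\<in>F. x l * y l)}" for J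
  have "\<exists>J. finite J \<and> \<iota> ` F \<subseteq> J \<and> (\<forall>x. (\<forall>l. l \<notin> F \<longrightarrow> x l = 0) \<longrightarrow>
      (\<Sum>i\<in>J. mixed_term x i) \<le> 1 \<longrightarrow> (\<Sum>l\<in>F. x l * y l) \<le> C + e)"
  proof (rule ccontr)
    assume neg: "\<not> ?thesis"
    have "K \<inter> (\<Inter>J\<in>{J. finite J}. Z J) \<noteq> {}"
    proof (rule compact_imp_fip_image)
      show "compact K" unfolding K_def by (rule compact_box) (simp add: Q_def)
      show "closed (Z J)" for J
        unfolding Z_def
        by (intro closed_Int closed_mixed_ball closed_Collect_le continuous_on_const continuous_on_pairing)
      fix I' :: "'i set set" assume I': "finite I'" "I' \<subseteq> {J. finite J}"
      define J where "J = \<iota> ` F \<union> \<Union>I'"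
      have J: "finite J" "\<iota> ` F \<subseteq> J" unfolding J_def using F I' by auto
      then obtain x where x: "\<And>l. l \<notin> F \<Longrightarrow> x l = 0" "(\<Sum>i\<in>J. mixed_term x i) \<le> 1"
        "\<not> (\<Sum>l\<in>F. x l * y l) \<le> C + e" using neg by blast
      have "x l \<in> Q l" for l
        using coordinate_le_inverse_weight[OF \<iota> J(1) _ x(2), of l] J(2) x(1)
        by (cases "l \<in> F") (auto simp: Q_def abs_le_iff)
      moreover have "x \<in> Z J'" if "J' \<in> I'" for J'
      proof -
        have "(\<Sum>i\<in>J'. mixed_term x i) \<le> (\<Sum>i\<in>J. mixed_term x i)"
          using that J(1) mixed_term_nonneg by (intro sum_mono2) (auto simp: J_def)
        then show ?thesis using x by (simp add: Z_def)
      qed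
      ultimately have "x \<in> K \<inter> (\<Inter>J\<in>I'. Z J)" by (simp add: K_def)
      then show "K \<inter> (\<Inter>J\<in>I'. Z J) \<noteq> {}" by blast
    qed
    then obtain x where "x \<in> K" and xZ: "\<And>J. finite J \<Longrightarrow> x \<in> Z J" by auto
    have x0: "x l = 0" if "l \<notin> F" for l
    proof -
      have "x l \<in> Q l" using \<open>x \<in> K\<close> by (simp add: K_def)
      then show ?thesis using that by (simp add: Q_def)
    qed
    have fin: "finitely_supported x" by (rule finite_subset[OF _ F]) (use x0 in auto)
    have "(\<Sum>i\<in>A. mixed_term x i) \<le> 1" if "finite A" for A using xZ[OF that] by (simp add: Z_def)
    from bounded_sums_summable(2)[OF mixed_term_nonneg this]
    have "mixed_norm x \<le> 1 powr (1 / r)"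
      unfolding mixed_norm_def using r_gt
      by (intro powr_mono2) (auto intro: infsum_nonneg mixed_term_nonneg)
    then have "C * mixed_norm x \<le> C * 1" using C by (intro mult_left_mono) auto
    moreover have "(\<Sum>\<^sub>\<infinity>l. x l * y l) = (\<Sum>l\<in>F. x l * y l)"
      by (rule infsum_finite_support(1)[OF F]) (simp add: x0)
    moreover have "C + e \<le> (\<Sum>l\<in>F. x l * y l)" using xZ[of "{}"] by (simp add: Z_def)
    ultimately show False using le[OF fin] e by linarith
  qed
  then obtain J where "finite J" "\<iota> ` F \<subseteq> J" "\<forall>x. (\<forall>l. l \<notin> F \<longrightarrow> x l = 0) \<longrightarrow>
      (\<Sum>i\<in>J. mixed_term x i) \<le> 1 \<longrightarrow> (\<Sum>l\<in>F. x l * y l) \<le> C + e" by blast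
  then show ?thesis using that[of J] \<iota> by blast
qed

lemma abs_le_local_norm:
  assumes "l \<in> S i"
  shows "\<bar>b l\<bar> \<le> local_norm b i"
proof -
  have "\<bar>b l\<bar> powr p' \<le> (\<Sum>l\<in>S i. \<bar>b l\<bar> powr p')"
    using finite_S by (intro member_le_sum assms) auto
  then have "(\<bar>b l\<bar> powr p') powr (1 / p') \<le> local_norm b i"
    unfolding local_norm_def using p'_gt by (intro powr_mono2) auto
  then show ?thesis using p'_gt by (simp add: powr_powr)
qed

text \<open>
  Compactness argument in the space of all families of pieces. Condition \<open>(A, l, t)\<close> asks for the
  norm bound on the finite index set \<open>A\<close>, and that the pieces from \<open>A\<close> add up to \<open>y l\<close> at the point \<open>l\<close>
  with error at most \<open>D * t\<close>. The index set \<open>I\<close> admits \<open>t\<close> only if it dominates the \<open>\<ell>\<^sup>r\<close> norm of the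
  weights at \<open>l\<close> outside \<open>A\<close>: by Hoelder that is what any decomposition of norm at most \<open>D\<close> can
  miss. So an exact decomposition on finitely many points fulfils all conditions at these points,
  and since \<open>t\<close> can be made small, a family fulfilling all conditions decomposes \<open>y\<close>.
\<close>

lemma atomic_space_norming_eps:
  assumes C: "0 \<le> C" and e: "0 < e"
    and le: "\<And>x. finitely_supported x \<Longrightarrow> \<bar>\<Sum>\<^sub>\<infinity>l. x l * y l\<bar> \<le> C * mixed_norm x"
  shows "y \<in> atomic_space \<and> atomic_norm y \<le> C + e"
proof -
  define D where "D = C + e"
  have D: "D > 0" using C e by (simp add: D_def)
  define v where "v l i = (if l \<in> S i then w i powr r else 0)" for l i
  \<comment> \<open>Each coordinate of a piece is at most its local norm, which is at most \<open>w i * D\<close>.\<close>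
  define K where "K = {b. \<forall>i. b i \<in> {a. \<forall>l. a l \<in> (if l \<in> S i then {- (w i * D) .. w i * D} else {0})}}"
  define Z where "Z = (\<lambda>(A, l, t). {b. (\<Sum>i\<in>A. (local_norm (b i) i / w i) powr r') \<le> D powr r'}
      \<inter> {b. \<bar>(\<Sum>i\<in>A. b i l) - y l\<bar> \<le> D * t})"
  define I where "I = {(A, l, t). finite A \<and> 0 \<le> t \<and>
      (\<forall>A'. finite A' \<longrightarrow> A' \<inter> A = {} \<longrightarrow> (\<Sum>i\<in>A'. v l i) \<le> t powr r)}"
  have coord: "continuous_on UNIV (\<lambda>b::'i \<Rightarrow> int \<Rightarrow> real. b i l)" for i l
    by (rule continuous_on_product_then_coordinatewise[OF continuous_on_product_coordinates])
  have "K \<inter> (\<Inter>k\<in>I. Z k) \<noteq> {}"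
  proof (rule compact_imp_fip_image)
    show "compact K" unfolding K_def by (intro compact_box) auto
    show "closed (Z k)" for k
    proof -
      obtain A l t where k: "k = (A, l, t)" by (cases k)
      have "continuous_on UNIV (\<lambda>b. local_norm (b i) i / w i)" for i
        unfolding local_norm_def using p'_gt w_pos[of i]
        by (intro continuous_on_powr' continuous_intros coord) (auto intro!: sum_nonneg)
      moreover have "0 \<le> local_norm a i / w i" for a i
        using w_pos[of i] by (simp add: local_norm_def)
      ultimately have c1: "continuous_on UNIV (\<lambda>b. (local_norm (b i) i / w i) powr r')" for i
        using r'_gt by (intro continuous_on_powr' continuous_on_const) auto
      have c2: "continuous_on UNIV (\<lambda>b::'i \<Rightarrow> int \<Rightarrow> real. \<bar>(\<Sum>i\<in>A. b i l) - y l\<bar>)"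
        by (intro continuous_intros coord)
      show ?thesis
        unfolding Z_def k prod.case
        by (intro closed_Int closed_Collect_le continuous_on_sum c1 c2 continuous_on_const)
    qed
    fix I' assume I': "finite I'" "I' \<subseteq> I"
    define F where "F = (\<lambda>(A, l, t). l) ` I'"
    have F: "finite F" using I' by (simp add: F_def)
    obtain J where J: "finite J" and cover: "\<And>l. l \<in> F \<Longrightarrow> \<exists>i\<in>J. l \<in> S i"
      and leJ: "\<And>x. (\<And>l. l \<notin> F \<Longrightarrow> x l = 0) \<Longrightarrow> (\<Sum>i\<in>J. mixed_term x i) \<le> 1 \<Longrightarrow>
        (\<Sum>l\<in>F. x l * y l) \<le> D"
      using finite_subfamily_suffices[OF F C e le] unfolding D_def by blast
    obtain x m where m: "0 \<le> m" "m \<le> D" and x: "(\<Sum>i\<in>J. mixed_term x i) \<le> 1"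
      and y: "\<And>l. l \<in> F \<Longrightarrow> y l = m * (\<Sum>i\<in>J. duality_map x i l)"
      using finite_duality[OF F J cover leJ] by blast
    \<comment> \<open>Scaled by the maximum \<open>m\<close>, the gradient at the maximizer is exactly \<open>y\<close> on \<open>F\<close>.\<close>
    define b where "b i l = (if i \<in> J then m * duality_map x i l else 0)" for i l
    have b_norm: "local_norm (b i) i / w i = (if i \<in> J then m * mixed_term x i powr (1 / r') else 0)" for i
    proof (cases "i \<in> J")
      case True
      then have "b i = (\<lambda>l. m * duality_map x i l)" by (simp add: b_def fun_eq_iff)
      then show ?thesis
        using True m(1) w_pos[of i] by (simp add: local_norm_scale duality_map_norm)
    qed (simp add: b_def local_norm_def)
    have sums: "(\<Sum>i\<in>A. (local_norm (b i) i / w i) powr r') \<le> D powr r'" if A: "finite A" for A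
    proof -
      have "(\<Sum>i\<in>A. (local_norm (b i) i / w i) powr r') = (\<Sum>i\<in>A \<inter> J. m powr r' * mixed_term x i)"
        unfolding b_norm using A r'_gt m(1) mixed_term_nonneg
        by (intro sum.mono_neutral_cong_right) (auto simp: powr_mult powr_powr)
      also have "\<dots> \<le> (\<Sum>i\<in>J. m powr r' * mixed_term x i)"
        using J mixed_term_nonneg by (intro sum_mono2) auto
      also have "\<dots> = m powr r' * (\<Sum>i\<in>J. mixed_term x i)" by (simp add: sum_distrib_left)
      also have "\<dots> \<le> m powr r' * 1" using x by (intro mult_left_mono) auto
      also have "\<dots> \<le> D powr r'" using m r'_gt by (simp add: powr_mono2)
      finally show ?thesis .
    qed
    have ln0: "0 \<le> local_norm (b i) i / w i" for i
      using w_pos[of i] by (simp add: local_norm_def)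
    have "b \<in> K"
    proof -
      have "b i l \<in> (if l \<in> S i then {- (w i * D) .. w i * D} else {0})" for i l
      proof (cases "l \<in> S i")
        case True
        have "((local_norm (b i) i / w i) powr r') powr (1 / r') \<le> (D powr r') powr (1 / r')"
          using sums[of "{i}"] r'_gt by (intro powr_mono2[of "1 / r'"]) simp_all
        then have "local_norm (b i) i / w i \<le> D"
          using abs_of_nonneg[OF ln0[of i]] D r'_gt by (simp add: powr_powr)
        then have "local_norm (b i) i \<le> w i * D" using w_pos[of i] by (simp add: field_simps)
        then have "\<bar>b i l\<bar> \<le> w i * D" using abs_le_local_norm[OF True, of "b i"] by linarith
        then show ?thesis using True by (simp add: abs_le_iff)
      next
        case False
        then show ?thesis by (simp add: b_def duality_map_def)
      qed
      then show ?thesis by (simp add: K_def)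
    qed
    moreover have "b \<in> Z k" if k: "k \<in> I'" for k
    proof -
      obtain A l t where k_eq: "k = (A, l, t)" by (cases k)
      have A: "finite A" and t: "0 \<le> t"
        and vt: "\<And>A'. finite A' \<Longrightarrow> A' \<inter> A = {} \<Longrightarrow> (\<Sum>i\<in>A'. v l i) \<le> t powr r"
        using k I'(2) by (auto simp: I_def k_eq)
      have l: "l \<in> F" unfolding F_def using k by (force simp: k_eq)
      have yl: "y l = (\<Sum>i\<in>J. b i l)" unfolding y[OF l] by (simp add: b_def sum_distrib_left)
      have "(\<Sum>i\<in>A. b i l) = (\<Sum>i\<in>A \<inter> J. b i l)"
        using A by (intro sum.mono_neutral_right) (auto simp: b_def)
      moreover have "y l = (\<Sum>i\<in>A \<inter> J. b i l) + (\<Sum>i\<in>J - A. b i l)"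
        unfolding yl using J by (metis inf_commute sum.Int_Diff)
      ultimately have "\<bar>(\<Sum>i\<in>A. b i l) - y l\<bar> = \<bar>\<Sum>i\<in>J - A. b i l\<bar>" by simp
      also have "\<dots> \<le> (\<Sum>i\<in>J - A. \<bar>b i l\<bar>)" by (rule sum_abs)
      also have "\<dots> \<le> (\<Sum>i\<in>J - A. \<bar>v l i powr (1 / r) * (local_norm (b i) i / w i)\<bar>)"
      proof (rule sum_mono)
        fix i
        show "\<bar>b i l\<bar> \<le> \<bar>v l i powr (1 / r) * (local_norm (b i) i / w i)\<bar>"
        proof (cases "l \<in> S i")
          case True
          then show ?thesis
            using abs_le_local_norm[OF True, of "b i"] w_pos[of i] r_gt by (simp add: v_def powr_powr)
        next
          case False
          then show ?thesis by (simp add: b_def duality_map_def)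
        qed
      qed
      also have "\<dots> \<le> (\<Sum>i\<in>J - A. \<bar>v l i powr (1 / r)\<bar> powr r) powr (1 / r)
          * (\<Sum>i\<in>J - A. \<bar>local_norm (b i) i / w i\<bar> powr r') powr (1 / r')"
        by (rule Holder_sum[OF r_gt r'_gt conj_r])
      also have "\<dots> \<le> (t powr r) powr (1 / r) * (D powr r') powr (1 / r')"
      proof (intro mult_mono powr_mono2)
        have "(\<Sum>i\<in>J - A. \<bar>v l i powr (1 / r)\<bar> powr r) = (\<Sum>i\<in>J - A. v l i)"
          using r_gt by (simp add: powr_powr v_def)
        also have "\<dots> \<le> t powr r" using J by (intro vt) auto
        finally show "(\<Sum>i\<in>J - A. \<bar>v l i powr (1 / r)\<bar> powr r) \<le> t powr r" .
        show "(\<Sum>i\<in>J - A. \<bar>local_norm (b i) i / w i\<bar> powr r') \<le> D powr r'"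
          using sums[of "J - A"] J ln0 by (simp only: abs_of_nonneg[OF ln0] finite_Diff)
      qed (use r_gt r'_gt in \<open>auto intro!: sum_nonneg\<close>)
      also have "\<dots> = D * t" using t D r_gt r'_gt by (simp add: powr_powr)
      finally show ?thesis using sums[OF A] by (simp add: Z_def k_eq)
    qed
    ultimately show "K \<inter> (\<Inter>k\<in>I'. Z k) \<noteq> {}" by blast
  qed
  then obtain b where bK: "b \<in> K" and bZ: "\<And>k. k \<in> I \<Longrightarrow> b \<in> Z k" by blast
  have vsum: "v l summable_on UNIV" for l
    unfolding v_def using weights_summable[of l]
    by (rule summable_on_cong_neutral[THEN iffD1, rotated -1]) auto
  have tail: "\<exists>J. finite J \<and> (\<forall>A. finite A \<longrightarrow> J \<subseteq> A \<longrightarrow> (A, l, t) \<in> I)" if t: "t > 0" for l t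
  proof -
    have tr: "t powr r > 0" using t by simp
    have v0: "v l i \<ge> 0" for i by (simp add: v_def)
    obtain J where J: "finite J" "\<And>A. finite A \<Longrightarrow> A \<inter> J = {} \<Longrightarrow> sum (v l) A \<le> t powr r"
      by (rule summable_tail_small[OF vsum v0 tr]) blast
    have "(A, l, t) \<in> I" if A: "finite A" "J \<subseteq> A" for A
    proof -
      have "sum (v l) A' \<le> t powr r" if "finite A'" "A' \<inter> A = {}" for A'
        using J(2)[OF that(1)] that(2) A(2) by blast
      then show ?thesis using A(1) t by (simp add: I_def)
    qed
    then show ?thesis using J(1) by blast
  qed
  have part: "(\<Sum>i\<in>A. (local_norm (b i) i / w i) powr r') \<le> D powr r'" if A: "finite A" for A
  proof -
    obtain J where J: "finite J" "\<And>A. finite A \<Longrightarrow> J \<subseteq> A \<Longrightarrow> (A, 0, 1) \<in> I"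
      using tail[of 1 0] by auto
    have "(\<Sum>i\<in>A. (local_norm (b i) i / w i) powr r') \<le> (\<Sum>i\<in>A \<union> J. (local_norm (b i) i / w i) powr r')"
      using A J(1) by (intro sum_mono2) auto
    also have "\<dots> \<le> D powr r'" using bZ[OF J(2)[of "A \<union> J"]] A J(1) by (simp add: Z_def)
    finally show ?thesis .
  qed
  have sum: "((\<lambda>i. b i l) has_sum y l) UNIV" for l
    unfolding has_sum_def
  proof (rule tendstoI)
    fix \<epsilon> :: real assume \<epsilon>: "\<epsilon> > 0"
    define t where "t = \<epsilon> / (2 * D)"
    have t: "t > 0" using \<epsilon> D by (simp add: t_def)
    obtain J where J: "finite J" "\<And>A. finite A \<Longrightarrow> J \<subseteq> A \<Longrightarrow> (A, l, t) \<in> I" using tail[OF t] by blast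
    have "dist (\<Sum>i\<in>A. b i l) (y l) < \<epsilon>" if A: "finite A" "J \<subseteq> A" for A
    proof -
      have "\<bar>(\<Sum>i\<in>A. b i l) - y l\<bar> \<le> D * t" using bZ[OF J(2)[OF A]] by (simp add: Z_def)
      also have "\<dots> < \<epsilon>" using \<epsilon> D by (simp add: t_def)
      finally show ?thesis by (simp add: dist_real_def)
    qed
    then show "\<forall>\<^sub>F A in finite_subsets_at_top UNIV. dist (\<Sum>i\<in>A. b i l) (y l) < \<epsilon>"
      unfolding eventually_finite_subsets_at_top using J(1) by blast
  qed
  have supp: "{l. b i l \<noteq> 0} \<subseteq> S i" for i
  proof
    fix l assume "l \<in> {l. b i l \<noteq> 0}"
    moreover have "b i l \<in> (if l \<in> S i then {- (w i * D) .. w i * D} else {0})"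
      using bK by (simp add: K_def)
    ultimately show "l \<in> S i" by (auto split: if_splits)
  qed
  have \<beta>: "0 \<le> local_norm (b i) i / w i" "local_norm (b i) i \<le> w i * (local_norm (b i) i / w i)" for i
    using w_pos[of i] by (simp_all add: local_norm_def)
  show ?thesis
    using atomic_spaceI[where b = b and \<beta> = "\<lambda>i. local_norm (b i) i / w i" and B = D and y = y,
        OF supp \<beta> _ part sum] D by (simp add: D_def)
qed

lemma atomic_space_norming:
  assumes "0 \<le> C"
    and "\<And>x. finitely_supported x \<Longrightarrow> \<bar>\<Sum>\<^sub>\<infinity>l. x l * y l\<bar> \<le> C * mixed_norm x"
  shows "y \<in> atomic_space \<and> atomic_norm y \<le> C"
  using atomic_space_norming_eps[OF assms(1) _ assms(2)] by (meson field_le_epsilon zero_less_one)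

lemma atomic_norm_nonneg: "y \<in> atomic_space \<Longrightarrow> 0 \<le> atomic_norm y"
  by (intro atomic_norm_lower lp_norm_nonneg)

lemma mixed_atomic_dual_pair: "dual_pair mixed_space mixed_norm atomic_space atomic_norm"
proof unfold_locales
  show "0 \<le> mixed_norm x" for x by (simp add: mixed_norm_def)
qed (use finitely_supported_mixed finitely_supported_atomic atomic_norm_nonneg
    mixed_atomic_pair_le mixed_space_norming atomic_space_norming
    mixed_space_approx atomic_space_approx in auto)

end

section \<open>Dyadic intervals\<close>

lemma mem_dyadic_iff: "l \<in> dyadic j k \<longleftrightarrow> k = l div 2 ^ j"
proof -
  have "2 ^ j * k \<le> l \<and> l < 2 ^ j * (k + 1) \<longleftrightarrow> l div 2 ^ j = k"
  proof
    assume l: "2 ^ j * k \<le> l \<and> l < 2 ^ j * (k + 1)"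
    have "l = 2 ^ j * k + (l - 2 ^ j * k)" by simp
    moreover have "0 \<le> l - 2 ^ j * k" "l - 2 ^ j * k < 2 ^ j" using l by (auto simp: algebra_simps)
    ultimately show "l div 2 ^ j = k" by (intro int_div_pos_eq) auto
  next
    assume k: "l div 2 ^ j = k"
    have "l = 2 ^ j * k + l mod 2 ^ j" using k by (metis mult_div_mod_eq)
    moreover have "0 \<le> l mod 2 ^ j" "l mod 2 ^ j < 2 ^ j" by simp_all
    ultimately show "2 ^ j * k \<le> l \<and> l < 2 ^ j * (k + 1)"
      unfolding distrib_left mult_1_right by linarith
  qed
  then show ?thesis by (auto simp: dyadic_def)
qed

lemma card_dyadic: "card (dyadic j k) = 2 ^ j"
  by (simp add: dyadic_def distrib_left nat_power_eq)

theorem theorem2p4: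
  fixes p q r p' q' r' :: real
  assumes "1 < p" and "p < q" and "1 < r"
    and "1 / p + 1 / p' = 1" and "1 / q + 1 / q' = 1" and "1 / r + 1 / r' = 1"
  shows "is_predual (block_space p' q' r') (block_norm p' q' r') (bm_space p q r) (bm_norm p q r)
    \<and> isometric_isomorphism (block_space p' q' r') (block_norm p' q' r')
        (dual_space (bm_space p q r) (bm_norm p q r)) (dual_norm (bm_space p q r) (bm_norm p q r))
        (pairing_functional (bm_space p q r))
    \<and> isometric_isomorphism (bm_space p q r) (bm_norm p q r)
        (dual_space (block_space p' q' r') (block_norm p' q' r'))
        (dual_norm (block_space p' q' r') (block_norm p' q' r'))
        (pairing_functional (block_space p' q' r'))"
proof -
  define S where "S = (\<lambda>(j, k). dyadic j k)"
  define w :: "nat \<times> int \<Rightarrow> real" where "w = (\<lambda>(j, k). (2 ^ j) powr (1 / q - 1 / p))"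
  have conj_gt: "1 < s'" if "1 < s" "1 / s + 1 / s' = 1" for s s' :: real
  proof -
    have "1 / s > 0" "1 / s < 1" using that(1) by simp_all
    then have "0 < 1 / s'" "1 / s' < 1" using that(2) by linarith+
    then show ?thesis by (simp add: divide_less_eq split: if_splits)
  qed
  have qp: "1 / q - 1 / p < 0" using assms by (simp add: frac_less2)
  have "(\<lambda>i. w i powr r) summable_on {i. l \<in> S i}" for l
  proof -
    \<comment> \<open>Each scale \<open>j\<close> has one interval containing \<open>l\<close>, so the weights form a geometric series.\<close>
    define \<rho> where "\<rho> = 2 powr ((1 / q - 1 / p) * r)"
    have "(1 / q - 1 / p) * r < 0" using qp assms(3) by (simp add: mult_neg_pos)
    then have "2 powr ((1 / q - 1 / p) * r) < 2 powr 0" by (intro powr_less_mono) auto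
    then have \<rho>: "0 < \<rho>" "\<rho> < 1" by (simp_all add: \<rho>_def)
    have "summable (\<lambda>j. \<rho> ^ j)" using \<rho> by (intro summable_geometric) simp
    then have geom: "(\<lambda>j. \<rho> ^ j) summable_on UNIV"
      using \<rho> by (intro norm_summable_imp_summable_on) simp
    have "{i. l \<in> S i} = range (\<lambda>j. (j, l div 2 ^ j))"
      by (auto simp: S_def mem_dyadic_iff)
    moreover have "inj (\<lambda>j::nat. (j, l div 2 ^ j))" by (rule injI) simp
    moreover have "w (j, k) powr r = \<rho> ^ j" for j k
    proof -
      have "w (j, k) powr r = (2 powr real j) powr ((1 / q - 1 / p) * r)"
        by (simp add: w_def powr_powr powr_realpow)
      also have "\<dots> = \<rho> powr real j" by (simp add: \<rho>_def powr_powr mult.commute)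
      finally show ?thesis using \<rho> by (simp add: powr_realpow)
    qed
    ultimately show ?thesis using geom by (simp add: summable_on_reindex o_def)
  qed
  moreover have "\<exists>i. l \<in> S i" for l
    by (rule exI[of _ "(0, l)"]) (simp add: S_def mem_dyadic_iff)
  ultimately interpret weighted_cover S w p p' r r'
    using assms conj_gt[OF assms(1,4)] conj_gt[OF assms(3,6)]
    by unfold_locales (auto simp: S_def w_def dyadic_def)
  have "mixed_term x = bm_term p q r x" for x
    unfolding fun_eq_iff mixed_term_def bm_term_def energy_def
    by (auto simp: S_def w_def powr_powr mult.commute)
  then have mixed: "mixed_space = bm_space p q r" "mixed_norm = bm_norm p q r"
    by (simp_all add: mixed_space_def bm_space_def mixed_norm_def[abs_def] bm_norm_def[abs_def])
  \<comment> \<open>The normalisation of blocks is the weight, because \<open>1/p' - 1/q' = 1/q - 1/p\<close>.\<close>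
  have "1 / p' - 1 / q' = 1 / q - 1 / p" using assms(4,5) by linarith
  then have "is_block q' p' j k = atom (j, k)" for j k
    unfolding fun_eq_iff is_block_def atom_def by (simp add: S_def w_def card_dyadic)
  then have "block_rep p' q' r' = atomic_rep"
    by (simp add: fun_eq_iff block_rep_def atomic_rep_def)
  then have atomic: "atomic_space = block_space p' q' r'" "atomic_norm = block_norm p' q' r'"
    by (simp_all add: fun_eq_iff atomic_space_def block_space_def atomic_norm_def block_norm_def)
  show ?thesis
    using dual_pair.predual_and_dualities[OF mixed_atomic_dual_pair] unfolding mixed atomic .
qed

end
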